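(* Let $k\neq0$ and $\kappa\ne0$. Upon taking images in $\Gamma(G,\mathrm{Lie}(SD_{G,k}))$, one has $$\mathcal Vir^+=\mathcal Vir^l,\qquad \mathcal Vir^-=\mathcal Vir^r$$ if and only if $\kappa=k/2$.
   Context: $G$ is a real Lie group, either compact simple or $GL(n,\mathbb R)$, $\mathfrak g=\mathrm{Lie}\,G$, $g$ is a nondegenerate invariant symmetric bilinear form on $\mathfrak g$ (the trace form for $GL(n,\mathbb R)$), also denoting the bi-invariant metric on $G$, and $H$ is the bi-invariant closed 3-form on $G$ obtained from $H(x,y,z)=g([x,y],z)$ by left translation. $\Sigma=\Sigma'\times\Sigma''$ is 2-dimensional with coordinates $\sigma$ (étale, on $\Sigma'$) and $\tau$ (on the open set $\Sigma''\subset\mathbb R$), $G_\Sigma=G\times\Sigma$. **$SD_{G,k}$.** As a sheaf of commutative algebras on $G$ it is the sheaf of functions on $J^\infty(T^*G_{\Sigma/\Sigma''})$, the $\infty$-jets in the $\sigma$-direction of sections of $T^*G\times\Sigma\to\Sigma$ (smooth on $G_\Sigma$, polynomial in the fibre coordinates of $T^*G$ and in positive order jets). It is a sheaf of vertex Poisson algebras with $T$ the total $\sigma$-derivative $\rho(\partial_\sigma)$. Vector fields $\xi$ along $G$ are identified with fibrewise linear functions on $T^*G$ and 1-forms $f\,dh$ with $f\,\partial_\sigma h$; for those not depending explicitly on $\sigma$ the products are $\xi_{(0)}F=\xi F$, $(\xi+\omega)_{(1)}(\xi'+\omega')=\iota_\xi\omega'+\iota_{\xi'}\omega$, $(\xi+\omega)_{(0)}(\xi'+\omega')=[\xi,\xi']+\mathrm{Lie}_\xi\omega'-\mathrm{Lie}_{\xi'}\omega+\partial_\sigma(\iota_{\xi'}\omega)-\frac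 k2H(\xi,\xi',\cdot)$. $\mathrm{Lie}(SD_{G,k})=SD_{G,k}/\rho(\partial_\sigma)SD_{G,k}$ with bracket ${}_{(0)}$. **$\mathcal Vir^{l}$, $\mathcal Vir^r$.** Let $j^0_l(x)$ be the left-invariant vector field with value $x\in\mathfrak g$ at the identity, $j^0_r(x)$ the right-invariant one with value $-x$, and $j^k_l(x)=j^0_l(x)+\frac k2g(j^0_l(x),\cdot)$, $j^k_r(x)=j^0_r(x)-\frac k2g(j^0_r(x),\cdot)$ in degree 1 of $\Gamma(G,SD_{G,k})$. For dual bases $\{e_a\},\{e^a\}$ of $\mathfrak g$ with respect to $g$ put $L^{l}=\frac1k\sum_aj^k_{l}(e_a)j^k_{l}(e^a)$ and $L^{r}=\frac1k\sum_aj^k_{r}(e_a)j^k_{r}(e^a)$ (Sugawara elements). $\mathcal Vir^l$ and $\mathcal Vir^r$ are the spans of the classes of $f(\sigma+\tau)L^l$ and of $f(\sigma-\tau)L^r$ respectively, $f$ an arbitrary smooth function of one variable. **$\mathcal Vir^\pm$.** For the Lagrangian $L_\kappa=\frac\kappa2g\big((\partial_\tau-\partial_\sigma)x,(\partial_\tau+\partial_\sigma)x\big)d\tau\wedge d\sigma$ for maps $x:\Sigma\to G$, and also for its modification by the Wess–Zumino term with 3-form $-\frac k2H$, the conformal symmetries $\frac12f(\sigma\pm\tau)(\partial_\sigma\pm\partial_\tau)$ have integrals of motion whose restrictions to $d\tau=0$ are, up to sign, $f(\sigma\pm\tau)\,\kappa\,g(\partial_\pm x,\partial_\pm x)\,d\sigma$,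 $\partial_\pm=\frac12(\partial_\sigma\pm\partial_\tau)$. The Legendre transform of $L_\kappa$ (without the Wess–Zumino term), i.e. momentum $p=\kappa\,g(\partial_\tau x,\cdot)\in T^*G$, turns $\kappa\,g(\partial_\pm x,\partial_\pm x)$ into the global section $\frac14\big(\kappa^{-1}g^{-1}(p,p)\pm2\langle p,\partial_\sigma x\rangle+\kappa\,g(\partial_\sigma x,\partial_\sigma x)\big)$ of $SD_{G,k}$. $\mathcal Vir^\pm\subset\Gamma(G,\mathrm{Lie}(SD_{G,k}))$ is the span of the classes of $f(\sigma\pm\tau)$ times this element. *)

theory Defs
  imports "HOL-Analysis.Analysis" "HOL-Algebra.Group" "HOL-Library.Function_Algebras"
begin

text \<open>Real-valued functions on any set form a real vector space (pointwise operations), so that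
  \<^const>\<open>span\<close>, \<^const>\<open>subspace\<close> etc. apply to tangent vectors and to functions on jet spaces.\<close>

instantiation "fun" :: (type, real_vector) real_vector
begin

definition scaleR_fun :: "real \<Rightarrow> ('a \<Rightarrow> 'b) \<Rightarrow> 'a \<Rightarrow> 'b"
  where "scaleR_fun c f = (\<lambda>x. c *\<^sub>R f x)"

instance
  by standard (auto simp: scaleR_fun_def fun_eq_iff algebra_simps)

end

section \<open>Smooth manifolds and Lie groups\<close>

text \<open>Only meaningful for open \<open>S\<close>: all iterated directional derivatives up to order \<open>n\<close> exist
  and are continuous.\<close>

primrec higher_differentiable_on ::
    "'a::real_normed_vector set \<Rightarrow> ('a \<Rightarrow> 'b::real_normed_vector) \<Rightarrow> nat \<Rightarrow> bool" where
  "higher_differentiable_on S f 0 \<longleftrightarrow> continuous_on S f"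
| "higher_differentiable_on S f (Suc n) \<longleftrightarrow>
     (\<forall>x\<in>S. f differentiable (at x)) \<and>
     (\<forall>v. higher_differentiable_on S (\<lambda>x. frechet_derivative f (at x) v) n)"

definition smooth_on :: "'a::real_normed_vector set \<Rightarrow> ('a \<Rightarrow> 'b::real_normed_vector) \<Rightarrow> bool"
  where "smooth_on S f \<longleftrightarrow> (\<forall>n. higher_differentiable_on S f n)"

type_synonym ('g, 'e) chart = "'g set \<times> ('g \<Rightarrow> 'e)"

definition is_chart :: "'g topology \<Rightarrow> ('g, 'e::euclidean_space) chart \<Rightarrow> bool" where
  "is_chart X c \<longleftrightarrow> openin X (fst c) \<and> open (snd c ` fst c) \<and>
     homeomorphic_map (subtopology X (fst c)) (top_of_set (snd c ` fst c)) (snd c)"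

abbreviation chart_inv :: "('g, 'e) chart \<Rightarrow> 'e \<Rightarrow> 'g" where
  "chart_inv c \<equiv> inv_into (fst c) (snd c)"

definition smooth_manifold ::
    "'g topology \<Rightarrow> ('g, 'e::euclidean_space) chart set \<Rightarrow> bool" where
  "smooth_manifold X A \<longleftrightarrow>
     Hausdorff_space X \<and> second_countable X \<and>
     (\<forall>c\<in>A. is_chart X c) \<and> (\<Union>c\<in>A. fst c) = topspace X \<and>
     (\<forall>c\<in>A. \<forall>c'\<in>A. smooth_on (snd c ` (fst c \<inter> fst c')) (snd c' \<circ> chart_inv c))"

text \<open>The atlas need not be maximal; every notion below depends only on the smooth structure that
  it generates. The dimension of the group is \<open>DIM('e)\<close>, hence positive.\<close>

record ('g, 'e) lie_group = "'g monoid" +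
  gtop :: "'g topology"
  atlas :: "('g, 'e) chart set"

definition is_lie_group :: "('g, 'e::euclidean_space) lie_group \<Rightarrow> bool" where
  "is_lie_group G \<longleftrightarrow>
     group G \<and> topspace (gtop G) = carrier G \<and> smooth_manifold (gtop G) (atlas G) \<and>
     continuous_map (prod_topology (gtop G) (gtop G)) (gtop G) (\<lambda>(x, y). x \<otimes>\<^bsub>G\<^esub> y) \<and>
     continuous_map (gtop G) (gtop G) (\<lambda>x. inv\<^bsub>G\<^esub> x) \<and>
     (\<forall>c\<in>atlas G. \<forall>c'\<in>atlas G. \<forall>c''\<in>atlas G.
        smooth_on {(a, b). a \<in> snd c ` fst c \<and> b \<in> snd c' ` fst c' \<and>
                           chart_inv c a \<otimes>\<^bsub>G\<^esub> chart_inv c' b \<in> fst c''}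
          (\<lambda>(a, b). snd c'' (chart_inv c a \<otimes>\<^bsub>G\<^esub> chart_inv c' b))) \<and>
     (\<forall>c\<in>atlas G. \<forall>c'\<in>atlas G.
        smooth_on {a. a \<in> snd c ` fst c \<and> inv\<^bsub>G\<^esub> (chart_inv c a) \<in> fst c'}
          (\<lambda>a. snd c' (inv\<^bsub>G\<^esub> (chart_inv c a))))"

definition GL :: "(real^'n^'n, real^'n^'n) lie_group" where
  "GL = \<lparr>carrier = {A. invertible A}, mult = (**), one = mat 1,
         gtop = top_of_set {A. invertible A}, atlas = {({A. invertible A}, \<lambda>A. A)}\<rparr>"

section \<open>Tangent and cotangent vectors, the Lie algebra\<close>

text \<open>A tangent vector at \<open>x\<close> is the directional derivative it induces on functions that are smooth
  near \<open>x\<close>; it is extended by 0 to all other functions. A cotangent vector is a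
  linear functional on the tangent space, likewise extended by 0.\<close>

type_synonym 'g tvec = "('g \<Rightarrow> real) \<Rightarrow> real"
type_synonym 'g covec = "'g tvec \<Rightarrow> real"

definition smooth_near :: "('g, 'e::euclidean_space) lie_group \<Rightarrow> 'g \<Rightarrow> ('g \<Rightarrow> real) \<Rightarrow> bool" where
  "smooth_near G x f \<longleftrightarrow> (\<exists>V. openin (gtop G) V \<and> x \<in> V \<and>
     (\<forall>c\<in>atlas G. smooth_on (snd c ` (fst c \<inter> V)) (f \<circ> chart_inv c)))"

definition coord_vec ::
    "('g, 'e::euclidean_space) lie_group \<Rightarrow> ('g, 'e) chart \<Rightarrow> 'g \<Rightarrow> 'e \<Rightarrow> 'g tvec" where
  "coord_vec G c x a = (\<lambda>f. if smooth_near G x f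
     then frechet_derivative (f \<circ> chart_inv c) (at (snd c x)) a else 0)"

definition tangent_space :: "('g, 'e::euclidean_space) lie_group \<Rightarrow> 'g \<Rightarrow> 'g tvec set" where
  "tangent_space G x = {coord_vec G c x a | c a. c \<in> atlas G \<and> x \<in> fst c}"

definition cotangent_space :: "('g, 'e::euclidean_space) lie_group \<Rightarrow> 'g \<Rightarrow> 'g covec set" where
  "cotangent_space G x = {p.
     (\<forall>v\<in>tangent_space G x. \<forall>w\<in>tangent_space G x. p (v + w) = p v + p w) \<and>
     (\<forall>v\<in>tangent_space G x. \<forall>r. p (r *\<^sub>R v) = r * p v) \<and>
     (\<forall>v. v \<notin> tangent_space G x \<longrightarrow> p v = 0)}"

text \<open>The differential of a map \<open>F\<close>; used only for diffeomorphisms of \<open>G\<close>.\<close>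

definition push :: "('g \<Rightarrow> 'g) \<Rightarrow> 'g tvec \<Rightarrow> 'g tvec" where
  "push F v = (\<lambda>f. v (f \<circ> F))"

definition velocity :: "('g, 'e::euclidean_space) lie_group \<Rightarrow> (real \<Rightarrow> 'g) \<Rightarrow> real \<Rightarrow> 'g tvec" where
  "velocity G x s = (\<lambda>f. if smooth_near G (x s) f then deriv (f \<circ> x) s else 0)"

definition left_field :: "('g, 'e::euclidean_space) lie_group \<Rightarrow> 'g tvec \<Rightarrow> 'g \<Rightarrow> 'g tvec" where
  "left_field G y h = push (\<lambda>w. h \<otimes>\<^bsub>G\<^esub> w) y"

definition right_field :: "('g, 'e::euclidean_space) lie_group \<Rightarrow> 'g tvec \<Rightarrow> 'g \<Rightarrow> 'g tvec" where
  "right_field G y h = push (\<lambda>w. w \<otimes>\<^bsub>G\<^esub> h) y"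

definition lie_algebra :: "('g, 'e::euclidean_space) lie_group \<Rightarrow> 'g tvec set" where
  "lie_algebra G = tangent_space G \<one>\<^bsub>G\<^esub>"

text \<open>The value at the identity of the commutator of the left-invariant vector fields.\<close>

definition lie_bracket ::
    "('g, 'e::euclidean_space) lie_group \<Rightarrow> 'g tvec \<Rightarrow> 'g tvec \<Rightarrow> 'g tvec" where
  "lie_bracket G y z = (\<lambda>f. if smooth_near G \<one>\<^bsub>G\<^esub> f
     then y (\<lambda>h. left_field G z h f) - z (\<lambda>h. left_field G y h f) else 0)"

definition simple_lie_algebra :: "('g, 'e::euclidean_space) lie_group \<Rightarrow> bool" where
  "simple_lie_algebra G \<longleftrightarrow>
     (\<exists>y\<in>lie_algebra G. \<exists>z\<in>lie_algebra G. lie_bracket G y z \<noteq> 0) \<and>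
     (\<forall>I. subspace I \<and> I \<subseteq> lie_algebra G \<and>
          (\<forall>y\<in>lie_algebra G. \<forall>z\<in>I. lie_bracket G y z \<in> I)
          \<longrightarrow> I = {0} \<or> I = lie_algebra G)"

definition compact_simple :: "('g, 'e::euclidean_space) lie_group \<Rightarrow> bool" where
  "compact_simple G \<longleftrightarrow> is_lie_group G \<and> compact_space (gtop G) \<and> connected_space (gtop G) \<and>
     simple_lie_algebra G"

definition adjoint :: "('g, 'e::euclidean_space) lie_group \<Rightarrow> 'g \<Rightarrow> 'g tvec \<Rightarrow> 'g tvec" where
  "adjoint G h y = push (\<lambda>w. h \<otimes>\<^bsub>G\<^esub> w \<otimes>\<^bsub>G\<^esub> inv\<^bsub>G\<^esub> h) y"

text \<open>Nondegenerate symmetric bilinear forms on the Lie algebra, invariant under the adjoint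
  action of \<open>G\<close>, i.e. those that extend to bi-invariant metrics.\<close>

definition invariant_form ::
    "('g, 'e::euclidean_space) lie_group \<Rightarrow> ('g tvec \<Rightarrow> 'g tvec \<Rightarrow> real) \<Rightarrow> bool" where
  "invariant_form G g \<longleftrightarrow>
     (\<forall>x\<in>lie_algebra G. \<forall>y\<in>lie_algebra G. \<forall>z\<in>lie_algebra G. g (x + y) z = g x z + g y z) \<and>
     (\<forall>x\<in>lie_algebra G. \<forall>y\<in>lie_algebra G. \<forall>r. g (r *\<^sub>R x) y = r * g x y) \<and>
     (\<forall>x\<in>lie_algebra G. \<forall>y\<in>lie_algebra G. g x y = g y x) \<and>
     (\<forall>x\<in>lie_algebra G. (\<forall>y\<in>lie_algebra G. g x y = 0) \<longrightarrow> x = 0) \<and>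
     (\<forall>h\<in>carrier G. \<forall>x\<in>lie_algebra G. \<forall>y\<in>lie_algebra G.
        g (adjoint G h x) (adjoint G h y) = g x y)"

text \<open>An element of the Lie algebra of \<^const>\<open>GL\<close> corresponds to the matrix of its values on
  the matrix entries.\<close>

definition gl_matrix :: "(real^'n^'n) tvec \<Rightarrow> real^'n^'n" where
  "gl_matrix v = (\<chi> i j. v (\<lambda>A. A $ i $ j))"

definition trace_form :: "(real^'n^'n) tvec \<Rightarrow> (real^'n^'n) tvec \<Rightarrow> real" where
  "trace_form v w = trace (gl_matrix v ** gl_matrix w)"

definition dual_bases :: "('g, 'e::euclidean_space) lie_group \<Rightarrow> ('g tvec \<Rightarrow> 'g tvec \<Rightarrow> real) \<Rightarrow>
    nat \<Rightarrow> (nat \<Rightarrow> 'g tvec) \<Rightarrow> (nat \<Rightarrow> 'g tvec) \<Rightarrow> bool" where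
  "dual_bases G g d e e' \<longleftrightarrow>
     inj_on e {..<d} \<and> independent (e ` {..<d}) \<and> span (e ` {..<d}) = lie_algebra G \<and>
     inj_on e' {..<d} \<and> independent (e' ` {..<d}) \<and> span (e' ` {..<d}) = lie_algebra G \<and>
     (\<forall>a<d. \<forall>b<d. g (e a) (e' b) = (if a = b then 1 else 0))"

definition metric :: "('g, 'e::euclidean_space) lie_group \<Rightarrow> ('g tvec \<Rightarrow> 'g tvec \<Rightarrow> real) \<Rightarrow>
    'g \<Rightarrow> 'g tvec \<Rightarrow> 'g tvec \<Rightarrow> real" where
  "metric G g x v w =
     g (push (\<lambda>y. inv\<^bsub>G\<^esub> x \<otimes>\<^bsub>G\<^esub> y) v) (push (\<lambda>y. inv\<^bsub>G\<^esub> x \<otimes>\<^bsub>G\<^esub> y) w)"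

definition sharp :: "('g, 'e::euclidean_space) lie_group \<Rightarrow> ('g tvec \<Rightarrow> 'g tvec \<Rightarrow> real) \<Rightarrow>
    'g \<Rightarrow> 'g covec \<Rightarrow> 'g tvec" where
  "sharp G g x p = (THE v. v \<in> tangent_space G x \<and> (\<forall>w\<in>tangent_space G x. metric G g x v w = p w))"

definition inverse_metric :: "('g, 'e::euclidean_space) lie_group \<Rightarrow> ('g tvec \<Rightarrow> 'g tvec \<Rightarrow> real) \<Rightarrow>
    'g \<Rightarrow> 'g covec \<Rightarrow> 'g covec \<Rightarrow> real" where
  "inverse_metric G g x p q = q (sharp G g x p)"

section \<open>The worldsheet and the jet space\<close>

text \<open>The surface is the product of a 1-dimensional manifold with a coordinate
  \<open>sig\<close> and of an open set \<open>taus\<close> of real numbers. The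
  smooth structure on the first factor is the one that makes \<open>sig\<close> a local diffeomorphism, i.e. its charts are
  the restrictions of \<open>sig\<close> to small open sets.\<close>

record 's worldsheet =
  stop :: "'s topology"
  sig :: "'s \<Rightarrow> real"
  taus :: "real set"

definition is_worldsheet :: "'s worldsheet \<Rightarrow> bool" where
  "is_worldsheet S \<longleftrightarrow>
     topspace (stop S) \<noteq> {} \<and> Hausdorff_space (stop S) \<and> second_countable (stop S) \<and>
     (\<forall>z\<in>topspace (stop S). \<exists>W. z \<in> W \<and> is_chart (stop S) (W, sig S)) \<and>
     taus S \<noteq> {} \<and> open (taus S)"

text \<open>Smoothness near \<open>s\<close> of a curve in the cotangent bundle: both the base point and the momenta
  conjugate to local coordinates are smooth.\<close>

definition smooth_section_at ::
    "('g, 'e::euclidean_space) lie_group \<Rightarrow> (real \<Rightarrow> 'g \<times> 'g covec) \<Rightarrow> real \<Rightarrow> bool" where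
  "smooth_section_at G u s \<longleftrightarrow> (\<exists>c\<in>atlas G. \<exists>I. open I \<and> s \<in> I \<and>
     (\<forall>t\<in>I. fst (u t) \<in> fst c \<and> snd (u t) \<in> cotangent_space G (fst (u t))) \<and>
     smooth_on I (\<lambda>t. snd c (fst (u t))) \<and>
     (\<forall>a. smooth_on I (\<lambda>t. snd (u t) (coord_vec G c (fst (u t)) a))))"

text \<open>A point \<open>(z, \<tau>, u)\<close> stands for the \<open>\<infinity>\<close>-jet at \<open>z\<close>, in the direction of \<open>\<sigma>\<close>, of a local
  section of the cotangent bundle over the slice \<open>\<tau>\<close>; near \<open>z\<close> the section is written in terms of
  the coordinate as the curve \<open>u\<close>, i.e. it maps \<open>z'\<close> to \<open>u (sig z')\<close>.
  Functions on the jet space are the functions of such triples that depend only on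
  the jet of \<open>u\<close> at \<open>sig z\<close>, as the elements of \<open>SD\<close> below do.\<close>

type_synonym ('s, 'g) jet = "'s \<times> real \<times> (real \<Rightarrow> 'g \<times> 'g covec)"

definition jets :: "('g, 'e::euclidean_space) lie_group \<Rightarrow> 's worldsheet \<Rightarrow> 'g set \<Rightarrow> ('s, 'g) jet set" where
  "jets G S U = {(z, \<tau>, u). z \<in> topspace (stop S) \<and> \<tau> \<in> taus S \<and>
     smooth_section_at G u (sig S z) \<and> fst (u (sig S z)) \<in> U}"

definition res :: "('g, 'e::euclidean_space) lie_group \<Rightarrow> 's worldsheet \<Rightarrow> 'g set \<Rightarrow>
    (('s, 'g) jet \<Rightarrow> real) \<Rightarrow> ('s, 'g) jet \<Rightarrow> real" where
  "res G S U F = (\<lambda>j. if j \<in> jets G S U then F j else 0)"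

text \<open>Smooth functions on \<open>V \<times> \<Sigma>\<close>, for \<open>V\<close> open in \<open>G\<close>.\<close>

definition smooth_coeff :: "('g, 'e::euclidean_space) lie_group \<Rightarrow> 's worldsheet \<Rightarrow> 'g set \<Rightarrow>
    ('g \<times> 's \<times> real \<Rightarrow> real) \<Rightarrow> bool" where
  "smooth_coeff G S V C \<longleftrightarrow> (\<forall>c\<in>atlas G. \<forall>W. is_chart (stop S) (W, sig S) \<longrightarrow>
     smooth_on ((snd c ` (fst c \<inter> V)) \<times> (sig S ` W) \<times> taus S)
       (\<lambda>(a, s, t). C (chart_inv c a, chart_inv (W, sig S) s, t)))"

text \<open>Polynomials in the momenta and in the positive order jets, in the coordinates given by the
  chart \<open>c\<close>, with coefficients smooth on \<open>V \<times> \<Sigma>\<close>.\<close>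

inductive_set jet_poly :: "('g, 'e::euclidean_space) lie_group \<Rightarrow> 's worldsheet \<Rightarrow> 'g set \<Rightarrow>
    ('g, 'e) chart \<Rightarrow> (('s, 'g) jet \<Rightarrow> real) set"
  for G S V c where
  coeff: "smooth_coeff G S V C \<Longrightarrow> (\<lambda>(z, \<tau>, u). C (fst (u (sig S z)), z, \<tau>)) \<in> jet_poly G S V c"
| base_jet: "1 \<le> i \<Longrightarrow> b \<in> Basis \<Longrightarrow>
    (\<lambda>(z, \<tau>, u). (deriv ^^ i) (\<lambda>s. snd c (fst (u s)) \<bullet> b) (sig S z)) \<in> jet_poly G S V c"
| fibre_jet: "b \<in> Basis \<Longrightarrow>
    (\<lambda>(z, \<tau>, u). (deriv ^^ i) (\<lambda>s. snd (u s) (coord_vec G c (fst (u s)) b)) (sig S z))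
      \<in> jet_poly G S V c"
| add: "P \<in> jet_poly G S V c \<Longrightarrow> Q \<in> jet_poly G S V c \<Longrightarrow> P + Q \<in> jet_poly G S V c"
| mult: "P \<in> jet_poly G S V c \<Longrightarrow> Q \<in> jet_poly G S V c \<Longrightarrow> P * Q \<in> jet_poly G S V c"

section \<open>The sheaf and its quotient by total derivatives\<close>

text \<open>The sections over an open subset \<open>U\<close> of \<open>G\<close>.
  The level \<open>k\<close> enters only the \<open>n\<close>-th products, not the algebra or the derivation \<open>total_deriv\<close>.\<close>

definition SD :: "('g, 'e::euclidean_space) lie_group \<Rightarrow> 's worldsheet \<Rightarrow> 'g set \<Rightarrow>
    (('s, 'g) jet \<Rightarrow> real) set" where
  "SD G S U = {F. (\<forall>j. j \<notin> jets G S U \<longrightarrow> F j = 0) \<and>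
     (\<forall>x\<in>U. \<exists>c\<in>atlas G. \<exists>V. openin (gtop G) V \<and> x \<in> V \<and> V \<subseteq> U \<inter> fst c \<and>
        (\<exists>P\<in>jet_poly G S V c. \<forall>j\<in>jets G S V. F j = P j))}"

text \<open>The total \<open>\<sigma>\<close>-derivative: evaluated on the jet of a section, it is the \<open>\<sigma>\<close>-derivative of the
  function pulled back along the jet prolongation of that section.\<close>

definition total_deriv :: "('g, 'e::euclidean_space) lie_group \<Rightarrow> 's worldsheet \<Rightarrow> 'g set \<Rightarrow>
    (('s, 'g) jet \<Rightarrow> real) \<Rightarrow> ('s, 'g) jet \<Rightarrow> real" where
  "total_deriv G S U F = res G S U (\<lambda>(z, \<tau>, u).
     Lim (atin (stop S) z) (\<lambda>w. (F (w, \<tau>, u) - F (z, \<tau>, u)) / (sig S w - sig S z)))"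

text \<open>A global section of the quotient sheaf \<open>SD / total_deriv SD\<close> is given by its family of germs;
  the germ at \<open>x\<close> of the class of \<open>F\<close> is the coset of all functions that differ from \<open>F\<close> by a
  total derivative over some neighbourhood of \<open>x\<close>.\<close>

definition lie_germ :: "('g, 'e::euclidean_space) lie_group \<Rightarrow> 's worldsheet \<Rightarrow>
    (('s, 'g) jet \<Rightarrow> real) \<Rightarrow> 'g \<Rightarrow> (('s, 'g) jet \<Rightarrow> real) set" where
  "lie_germ G S F x = {F'. \<exists>V. openin (gtop G) V \<and> x \<in> V \<and>
     res G S V (F' - F) \<in> total_deriv G S V ` SD G S V}"

definition lie_class :: "('g, 'e::euclidean_space) lie_group \<Rightarrow> 's worldsheet \<Rightarrow>
    (('s, 'g) jet \<Rightarrow> real) \<Rightarrow> 'g \<Rightarrow> (('s, 'g) jet \<Rightarrow> real) set" where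
  "lie_class G S F = (\<lambda>x. if x \<in> carrier G then lie_germ G S F x else {})"

section \<open>Currents, Sugawara elements and the Virasoro subspaces\<close>

text \<open>Vector fields are fibrewise linear functions on the cotangent bundle; a 1-form \<open>f dh\<close> is the
  function \<open>f \<partial>\<^sub>\<sigma>h\<close>, that is, the value of the 1-form on the velocity.\<close>

definition vector_function :: "('g, 'e::euclidean_space) lie_group \<Rightarrow> 's worldsheet \<Rightarrow>
    ('g \<Rightarrow> 'g tvec) \<Rightarrow> ('s, 'g) jet \<Rightarrow> real" where
  "vector_function G S \<xi> = res G S (carrier G)
     (\<lambda>(z, \<tau>, u). snd (u (sig S z)) (\<xi> (fst (u (sig S z)))))"

definition form_function :: "('g, 'e::euclidean_space) lie_group \<Rightarrow> 's worldsheet \<Rightarrow>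
    ('g \<Rightarrow> 'g covec) \<Rightarrow> ('s, 'g) jet \<Rightarrow> real" where
  "form_function G S \<omega> = res G S (carrier G)
     (\<lambda>(z, \<tau>, u). \<omega> (fst (u (sig S z))) (velocity G (fst \<circ> u) (sig S z)))"

definition current_l :: "('g, 'e::euclidean_space) lie_group \<Rightarrow> 's worldsheet \<Rightarrow>
    ('g tvec \<Rightarrow> 'g tvec \<Rightarrow> real) \<Rightarrow> real \<Rightarrow> 'g tvec \<Rightarrow> ('s, 'g) jet \<Rightarrow> real" where
  "current_l G S g k y = vector_function G S (left_field G y) +
     (k / 2) *\<^sub>R form_function G S (\<lambda>h. metric G g h (left_field G y h))"

definition current_r :: "('g, 'e::euclidean_space) lie_group \<Rightarrow> 's worldsheet \<Rightarrow>
    ('g tvec \<Rightarrow> 'g tvec \<Rightarrow> real) \<Rightarrow> real \<Rightarrow> 'g tvec \<Rightarrow> ('s, 'g) jet \<Rightarrow> real" where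
  "current_r G S g k y = vector_function G S (right_field G (- y)) -
     (k / 2) *\<^sub>R form_function G S (\<lambda>h. metric G g h (right_field G (- y) h))"

definition sugawara_l :: "('g, 'e::euclidean_space) lie_group \<Rightarrow> 's worldsheet \<Rightarrow>
    ('g tvec \<Rightarrow> 'g tvec \<Rightarrow> real) \<Rightarrow> real \<Rightarrow> nat \<Rightarrow> (nat \<Rightarrow> 'g tvec) \<Rightarrow> (nat \<Rightarrow> 'g tvec) \<Rightarrow>
    ('s, 'g) jet \<Rightarrow> real" where
  "sugawara_l G S g k d e e' =
     (1 / k) *\<^sub>R (\<Sum>a<d. current_l G S g k (e a) * current_l G S g k (e' a))"

definition sugawara_r :: "('g, 'e::euclidean_space) lie_group \<Rightarrow> 's worldsheet \<Rightarrow>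
    ('g tvec \<Rightarrow> 'g tvec \<Rightarrow> real) \<Rightarrow> real \<Rightarrow> nat \<Rightarrow> (nat \<Rightarrow> 'g tvec) \<Rightarrow> (nat \<Rightarrow> 'g tvec) \<Rightarrow>
    ('s, 'g) jet \<Rightarrow> real" where
  "sugawara_r G S g k d e e' =
     (1 / k) *\<^sub>R (\<Sum>a<d. current_r G S g k (e a) * current_r G S g k (e' a))"

text \<open>The Legendre transform of \<open>\<kappa> g(\<partial>\<^sub>\<plusminus>x, \<partial>\<^sub>\<plusminus>x)\<close>, with \<open>\<epsilon> = 1\<close> or \<open>\<epsilon> = -1\<close> for the sign.\<close>

definition energy :: "('g, 'e::euclidean_space) lie_group \<Rightarrow> 's worldsheet \<Rightarrow>
    ('g tvec \<Rightarrow> 'g tvec \<Rightarrow> real) \<Rightarrow> real \<Rightarrow> real \<Rightarrow> ('s, 'g) jet \<Rightarrow> real" where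
  "energy G S g \<kappa> \<epsilon> = res G S (carrier G) (\<lambda>(z, \<tau>, u).
     let x = fst (u (sig S z)); p = snd (u (sig S z)); x' = velocity G (fst \<circ> u) (sig S z)
     in 1/4 * (inverse \<kappa> * inverse_metric G g x p p + \<epsilon> * 2 * p x' + \<kappa> * metric G g x x' x'))"

text \<open>As \<^const>\<open>lie_class\<close> is the projection to a quotient, the span of the classes
  is the set of classes of the elements of the span.\<close>

definition vir :: "('g, 'e::euclidean_space) lie_group \<Rightarrow> 's worldsheet \<Rightarrow> real \<Rightarrow>
    (('s, 'g) jet \<Rightarrow> real) \<Rightarrow> ('g \<Rightarrow> (('s, 'g) jet \<Rightarrow> real) set) set" where
  "vir G S \<epsilon> L = lie_class G S `
     span {(\<lambda>(z, \<tau>, u). f (sig S z + \<epsilon> * \<tau>)) * L | f. smooth_on (UNIV :: real set) f}"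

definition vir_l where "vir_l G S g k d e e' = vir G S 1 (sugawara_l G S g k d e e')"
definition vir_r where "vir_r G S g k d e e' = vir G S (-1) (sugawara_r G S g k d e e')"
definition vir_plus where "vir_plus G S g \<kappa> = vir G S 1 (energy G S g \<kappa> 1)"
definition vir_minus where "vir_minus G S g \<kappa> = vir G S (-1) (energy G S g \<kappa> (-1))"

end

theory Submission
  imports Defs "HOL-Computational_Algebra.Polynomial"
begin

text \<open>
  Write \<open>p\<close> for the momentum and \<open>v\<close> for the \<open>\<sigma>\<close>-velocity of a jet. In the left trivialization of the
  tangent bundle the value of the left current of \<open>y\<close> is \<open>g(y, p\<^sup>\<sharp> + k/2 v)\<close>. Contracting two
  currents with dual bases gives the square length of \<open>p\<^sup>\<sharp> + k/2 v\<close>, so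
  \<open>L\<^sup>l = (1/k) g\<inverse>(p,p) + p(v) + (k/4) g(v,v)\<close>.
  For the right currents \<open>k\<close> is replaced by \<open>-k\<close> inside the square, and the invariance of the form
  removes the adjoint action by which right-invariant fields are twisted
  (\<open>left_contraction\<close>, \<open>right_contraction\<close>). For \<open>\<kappa> = k/2\<close> the energies are
  therefore one half of the Sugawara elements, as functions on the jet space
  (\<open>energy_eq_half_sugawara\<close>). The factor is absorbed by the arbitrary function in the definition
  of the Virasoro subspaces.

  Conversely, let the subspaces for the sign \<open>+\<close> coincide. The class of the energy is then the class
  of \<open>h(\<sigma> + \<tau>) L\<^sup>l\<close> for some smooth \<open>h\<close>, so
  \<open>(1/(4\<kappa>) - h/k) g\<inverse>(p,p) + (1/2 - h) p(v) + (\<kappa> - h k)/4 g(v,v)\<close>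
  is a total derivative near the identity. A total derivative of \<open>Q\<close>, restricted to a section, is the
  derivative of the restriction of \<open>Q\<close>, and \<open>Q\<close> depends on finitely many derivatives of the momentum.
  If two sections over the same curve have momenta that agree to high order at two points, Rolle's
  theorem gives a point between them where the expression takes the same value on both
  (\<open>total_deriv_agree_between\<close>). Taking momenta of opposite sign on a moving curve forces
  \<open>h = 1/2\<close>; taking a zero momentum and one that is not null on a constant curve forces
  \<open>h = k/(4\<kappa>)\<close>. Both hold at points arbitrarily close to a given one, hence at that point by continuity,
  and \<open>\<kappa> = k/2\<close> follows (\<open>vir_plus_eq_vir_l_imp_level\<close>).

  The argument applies to a group with smooth translations and an invariant nondegenerate form with
  dual bases. Lie groups have smooth translations by restriction of the smooth multiplication
  (\<open>lie_group_imp_smooth_group\<close>). For the general linear group translations are linear and the trace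
  form is invariant because the trace is (\<open>smooth_group_GL\<close>, \<open>invariant_form_trace_form\<close>).
\<close>

section \<open>Smooth functions on open sets\<close>

text \<open>On an open set the values of a function determine its derivatives, and these are all that the
  notion of higher differentiability refers to.\<close>

lemma higher_differentiable_on_cong:
  assumes "open S" "\<And>x. x \<in> S \<Longrightarrow> f x = g x" "higher_differentiable_on S f n"
  shows "higher_differentiable_on S g n"
  using assms(2,3)
proof (induction n arbitrary: f g)
  case 0
  then show ?case by (auto cong: continuous_on_cong)
next
  case (Suc n)
  have der: "(g has_derivative frechet_derivative f (at x)) (at x)" if "x \<in> S" for x
    by (rule has_derivative_transform_within_open[OF _ \<open>open S\<close> that Suc.prems(1)])
       (use Suc.prems(2) that in \<open>auto simp: frechet_derivative_works\<close>)
  then have "frechet_derivative f (at x) = frechet_derivative g (at x)" if "x \<in> S" for x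
    using frechet_derivative_at that by blast
  then have "higher_differentiable_on S (\<lambda>x. frechet_derivative g (at x) v) n" for v
    using Suc.IH[of "\<lambda>x. frechet_derivative f (at x) v"] Suc.prems(2) by auto
  with der show ?case by (auto simp: differentiable_def)
qed

lemma higher_differentiable_on_subset:
  "higher_differentiable_on T f n \<Longrightarrow> S \<subseteq> T \<Longrightarrow> higher_differentiable_on S f n"
  by (induction n arbitrary: f) (auto intro: continuous_on_subset)

lemma higher_differentiable_on_SucD:
  "higher_differentiable_on S f (Suc n) \<Longrightarrow> higher_differentiable_on S f n"
proof (induction n arbitrary: f)
  case 0
  then show ?case
    by (auto intro!: continuous_at_imp_continuous_on differentiable_imp_continuous_within)
next
  case (Suc n)
  show ?case
    using Suc.prems Suc.IH by (metis higher_differentiable_on.simps(2))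
qed

lemma higher_differentiable_on_Union:
  assumes "\<And>U. U \<in> \<U> \<Longrightarrow> open U" "\<And>U. U \<in> \<U> \<Longrightarrow> higher_differentiable_on U f n"
  shows "higher_differentiable_on (\<Union>\<U>) f n"
  using assms(2)
proof (induction n arbitrary: f)
  case 0
  then show ?case using assms(1) by (auto intro: continuous_on_open_Union)
qed auto

lemma higher_differentiable_on_const: "higher_differentiable_on S (\<lambda>x. c) n"
  by (induction n arbitrary: c) auto

lemma higher_differentiable_on_linear:
  assumes "bounded_linear L" "open S" "higher_differentiable_on S f n"
  shows "higher_differentiable_on S (\<lambda>x. L (f x)) n"
  using assms(3)
proof (induction n arbitrary: f)
  case 0
  then show ?case using assms(1) by (auto intro: bounded_linear.continuous_on)
next
  case (Suc n)
  have der: "((\<lambda>x. L (f x)) has_derivative (\<lambda>v. L (frechet_derivative f (at x) v))) (at x)"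
    if "x \<in> S" for x
    using Suc.prems that
    by (intro bounded_linear.has_derivative[OF assms(1)]) (auto simp: frechet_derivative_works)
  have "higher_differentiable_on S (\<lambda>x. frechet_derivative (\<lambda>x. L (f x)) (at x) v) n" for v
  proof (rule higher_differentiable_on_cong[OF \<open>open S\<close>])
    show "higher_differentiable_on S (\<lambda>x. L (frechet_derivative f (at x) v)) n"
      using Suc.prems by (intro Suc.IH) auto
    show "L (frechet_derivative f (at x) v) = frechet_derivative (\<lambda>x. L (f x)) (at x) v"
      if "x \<in> S" for x
      using frechet_derivative_at[OF der[OF that]] by metis
  qed
  with der show ?case by (auto simp: differentiable_def)
qed

lemma higher_differentiable_on_add:
  assumes "open S" "higher_differentiable_on S f n" "higher_differentiable_on S g n"
  shows "higher_differentiable_on S (\<lambda>x. f x + g x) n"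
  using assms(2,3)
proof (induction n arbitrary: f g)
  case 0
  then show ?case by (auto intro: continuous_on_add)
next
  case (Suc n)
  have der: "((\<lambda>x. f x + g x) has_derivative
      (\<lambda>v. frechet_derivative f (at x) v + frechet_derivative g (at x) v)) (at x)"
    if "x \<in> S" for x
    using Suc.prems that by (intro has_derivative_add) (auto simp: frechet_derivative_works)
  have "higher_differentiable_on S (\<lambda>x. frechet_derivative (\<lambda>x. f x + g x) (at x) v) n" for v
  proof (rule higher_differentiable_on_cong[OF \<open>open S\<close>])
    show "higher_differentiable_on S
        (\<lambda>x. frechet_derivative f (at x) v + frechet_derivative g (at x) v) n"
      using Suc.prems by (intro Suc.IH) auto
    show "frechet_derivative f (at x) v + frechet_derivative g (at x) v =
        frechet_derivative (\<lambda>x. f x + g x) (at x) v" if "x \<in> S" for x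
      using frechet_derivative_at[OF der[OF that]] by metis
  qed
  with der show ?case by (auto simp: differentiable_def)
qed

lemma higher_differentiable_on_sum:
  assumes "open S" "finite A" "\<And>i. i \<in> A \<Longrightarrow> higher_differentiable_on S (f i) n"
  shows "higher_differentiable_on S (\<lambda>x. \<Sum>i\<in>A. f i x) n"
  using assms(2,3)
  by (induction A)
     (auto simp: higher_differentiable_on_const intro!: higher_differentiable_on_add assms(1))

lemma higher_differentiable_on_scaleR:
  assumes "open S" "higher_differentiable_on S c n" "higher_differentiable_on S f n"
  shows "higher_differentiable_on S (\<lambda>x. c x *\<^sub>R f x) n"
  using assms(2,3)
proof (induction n arbitrary: c f)
  case 0
  then show ?case by (auto intro: continuous_on_scaleR)
next
  case (Suc n)
  have der: "((\<lambda>x. c x *\<^sub>R f x) has_derivative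
      (\<lambda>v. c x *\<^sub>R frechet_derivative f (at x) v + frechet_derivative c (at x) v *\<^sub>R f x)) (at x)"
    if "x \<in> S" for x
    using Suc.prems that by (intro has_derivative_scaleR) (auto simp: frechet_derivative_works)
  have low: "higher_differentiable_on S c n" "higher_differentiable_on S f n"
    using Suc.prems higher_differentiable_on_SucD by blast+
  have "higher_differentiable_on S (\<lambda>x. frechet_derivative (\<lambda>x. c x *\<^sub>R f x) (at x) v) n" for v
  proof (rule higher_differentiable_on_cong[OF \<open>open S\<close>])
    show "higher_differentiable_on S
        (\<lambda>x. c x *\<^sub>R frechet_derivative f (at x) v + frechet_derivative c (at x) v *\<^sub>R f x) n"
      using Suc.prems low by (intro higher_differentiable_on_add \<open>open S\<close> Suc.IH) auto
    show "c x *\<^sub>R frechet_derivative f (at x) v + frechet_derivative c (at x) v *\<^sub>R f x =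
        frechet_derivative (\<lambda>x. c x *\<^sub>R f x) (at x) v" if "x \<in> S" for x
      using frechet_derivative_at[OF der[OF that]] by metis
  qed
  with der show ?case by (auto simp: differentiable_def)
qed

text \<open>Expanding the chain rule in a basis turns the derivative of a composite into a sum of
  products of real functions with partial derivatives of the outer function at the inner one. The
  partial derivatives are again composites, of one order less, so the induction in the next lemma
  runs over the outer function.\<close>

lemma frechet_derivative_compose_Basis:
  fixes f :: "'a::real_normed_vector \<Rightarrow> 'b::euclidean_space"
  assumes "f differentiable (at x)" "g differentiable (at (f x))"
  shows "frechet_derivative (\<lambda>x. g (f x)) (at x) v =
    (\<Sum>b\<in>Basis. (frechet_derivative f (at x) v \<bullet> b) *\<^sub>R frechet_derivative g (at (f x)) b)"
proof -
  have lin: "linear (frechet_derivative g (at (f x)))"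
    using assms(2) linear_frechet_derivative by blast
  have "frechet_derivative (\<lambda>x. g (f x)) (at x) v =
      frechet_derivative g (at (f x)) (frechet_derivative f (at x) v)"
    using frechet_derivative_compose[OF assms] by (simp add: o_def)
  also have "frechet_derivative f (at x) v =
      (\<Sum>b\<in>Basis. (frechet_derivative f (at x) v \<bullet> b) *\<^sub>R b)"
    by (simp add: euclidean_representation)
  also have "frechet_derivative g (at (f x)) \<dots> =
      (\<Sum>b\<in>Basis. (frechet_derivative f (at x) v \<bullet> b) *\<^sub>R frechet_derivative g (at (f x)) b)"
    using lin by (simp only: linear_sum linear_scale)
  finally show ?thesis .
qed

lemma higher_differentiable_on_compose:
  fixes f :: "'a::real_normed_vector \<Rightarrow> 'b::euclidean_space"
  assumes "open S" "f ` S \<subseteq> T"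
    and "higher_differentiable_on S f n" "higher_differentiable_on T g n"
  shows "higher_differentiable_on S (\<lambda>x. g (f x)) n"
  using assms(3,4)
proof (induction n arbitrary: g)
  case 0
  then show ?case using assms(2) by (auto intro: continuous_on_compose2)
next
  case (Suc n)
  have diff: "f differentiable (at x)" "g differentiable (at (f x))" if "x \<in> S" for x
    using Suc.prems assms(2) that by auto
  have "higher_differentiable_on S (\<lambda>x. frechet_derivative (\<lambda>x. g (f x)) (at x) v) n" for v
  proof (rule higher_differentiable_on_cong[OF \<open>open S\<close>])
    show "higher_differentiable_on S (\<lambda>x. \<Sum>b\<in>Basis.
        (frechet_derivative f (at x) v \<bullet> b) *\<^sub>R frechet_derivative g (at (f x)) b) n"
      using Suc.prems higher_differentiable_on_SucD[OF Suc.prems(1)]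
      by (intro higher_differentiable_on_sum higher_differentiable_on_scaleR \<open>open S\<close>
          higher_differentiable_on_linear[OF bounded_linear_inner_left] Suc.IH) auto
  qed (simp add: frechet_derivative_compose_Basis diff)
  moreover have "(\<lambda>x. g (f x)) differentiable (at x)" if "x \<in> S" for x
    using differentiable_chain_at[OF diff[OF that]] by (simp add: o_def)
  ultimately show ?case by simp
qed

lemma smooth_on_cong:
  "open S \<Longrightarrow> smooth_on S f \<Longrightarrow> (\<And>x. x \<in> S \<Longrightarrow> f x = g x) \<Longrightarrow> smooth_on S g"
  unfolding smooth_on_def using higher_differentiable_on_cong by blast

lemma smooth_on_subset: "smooth_on T f \<Longrightarrow> S \<subseteq> T \<Longrightarrow> smooth_on S f"
  unfolding smooth_on_def using higher_differentiable_on_subset by blast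

lemma smooth_on_Union:
  "(\<And>U. U \<in> \<U> \<Longrightarrow> open U) \<Longrightarrow> (\<And>U. U \<in> \<U> \<Longrightarrow> smooth_on U f) \<Longrightarrow> smooth_on (\<Union>\<U>) f"
  unfolding smooth_on_def using higher_differentiable_on_Union by blast

lemma smooth_on_const: "smooth_on S (\<lambda>x. c)"
  by (simp add: smooth_on_def higher_differentiable_on_const)

lemma smooth_on_linear:
  "bounded_linear L \<Longrightarrow> open S \<Longrightarrow> smooth_on S f \<Longrightarrow> smooth_on S (\<lambda>x. L (f x))"
  by (simp add: smooth_on_def higher_differentiable_on_linear)

lemma smooth_on_add:
  "open S \<Longrightarrow> smooth_on S f \<Longrightarrow> smooth_on S g \<Longrightarrow> smooth_on S (\<lambda>x. f x + g x)"
  by (simp add: smooth_on_def higher_differentiable_on_add)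

lemma smooth_on_mult:
  fixes f g :: "'a::real_normed_vector \<Rightarrow> real"
  shows "open S \<Longrightarrow> smooth_on S f \<Longrightarrow> smooth_on S g \<Longrightarrow> smooth_on S (\<lambda>x. f x * g x)"
  using higher_differentiable_on_scaleR[of S f _ g] by (simp add: smooth_on_def)

lemma smooth_on_compose:
  fixes f :: "'a::real_normed_vector \<Rightarrow> 'b::euclidean_space"
  shows "open S \<Longrightarrow> f ` S \<subseteq> T \<Longrightarrow> smooth_on S f \<Longrightarrow> smooth_on T g \<Longrightarrow> smooth_on S (\<lambda>x. g (f x))"
  by (simp add: smooth_on_def higher_differentiable_on_compose)

lemma smooth_on_imp_differentiable: "smooth_on S f \<Longrightarrow> x \<in> S \<Longrightarrow> f differentiable (at x)"
  unfolding smooth_on_def by (meson higher_differentiable_on.simps(2))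

lemma smooth_on_imp_continuous_on: "smooth_on S f \<Longrightarrow> continuous_on S f"
  unfolding smooth_on_def by (meson higher_differentiable_on.simps(1))

lemma smooth_on_frechet_derivative:
  "smooth_on S f \<Longrightarrow> smooth_on S (\<lambda>x. frechet_derivative f (at x) v)"
  unfolding smooth_on_def using higher_differentiable_on.simps(2) by blast

lemma smooth_on_bounded_linear: "bounded_linear L \<Longrightarrow> smooth_on UNIV L"
  unfolding smooth_on_def
proof
  fix n assume L: "bounded_linear L"
  then have der: "(L has_derivative L) (at x)" for x
    by (rule bounded_linear_imp_has_derivative)
  show "higher_differentiable_on UNIV L n"
  proof (cases n)
    case 0
    then show ?thesis using L by (simp add: linear_continuous_on)
  next
    case (Suc m)
    have "frechet_derivative L (at x) = L" for x
      using frechet_derivative_at[OF der] by simp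
    then show ?thesis
      using der Suc by (auto simp: differentiable_def higher_differentiable_on_const)
  qed
qed

text \<open>For functions of one real variable, \<^const>\<open>deriv\<close> is the directional derivative in the
  direction 1.\<close>

lemma smooth_on_deriv:
  fixes f :: "real \<Rightarrow> real"
  assumes "open S" "smooth_on S f"
  shows "smooth_on S (deriv f)"
proof (rule smooth_on_cong[OF \<open>open S\<close> smooth_on_frechet_derivative[OF assms(2), of 1]])
  fix x assume "x \<in> S"
  then have "(f has_derivative frechet_derivative f (at x)) (at x)"
    using smooth_on_imp_differentiable[OF assms(2)] by (simp add: frechet_derivative_works)
  moreover have "frechet_derivative f (at x) = (*) (frechet_derivative f (at x) 1)"
  proof
    show "frechet_derivative f (at x) v = frechet_derivative f (at x) 1 * v" for v
      using linear_scale[OF has_derivative_linear[OF calculation], of v 1] by simp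
  qed
  ultimately show "frechet_derivative f (at x) 1 = deriv f x"
    by (metis DERIV_imp_deriv has_field_derivative_def)
qed

lemma smooth_on_higher_deriv:
  fixes f :: "real \<Rightarrow> real"
  shows "open S \<Longrightarrow> smooth_on S f \<Longrightarrow> smooth_on S ((deriv ^^ i) f)"
  by (induction i) (auto intro: smooth_on_deriv)

lemma higher_deriv_cong_open:
  fixes f g :: "real \<Rightarrow> real"
  assumes "open S" "\<And>x. x \<in> S \<Longrightarrow> f x = g x" "x \<in> S"
  shows "(deriv ^^ i) f x = (deriv ^^ i) g x"
  using assms(3)
proof (induction i arbitrary: x)
  case (Suc i)
  have "eventually (\<lambda>y. (deriv ^^ i) f y = (deriv ^^ i) g y) (nhds x)"
    using Suc assms(1) eventually_nhds by blast
  then show ?case by (simp add: deriv_cong_ev)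
qed (use assms in auto)

section \<open>Charts, smooth maps and tangent vectors\<close>

lemma chart_subset: "is_chart X c \<Longrightarrow> fst c \<subseteq> topspace X"
  by (simp add: is_chart_def openin_subset)

lemma chart_inj_on: "is_chart X c \<Longrightarrow> inj_on (snd c) (fst c)"
  using homeomorphic_imp_injective_map[of "subtopology X (fst c)" _ "snd c"] chart_subset[of X c]
  by (auto simp: is_chart_def Int_absorb1)

lemma chart_inv_left: "is_chart X c \<Longrightarrow> x \<in> fst c \<Longrightarrow> chart_inv c (snd c x) = x"
  by (simp add: chart_inj_on)

lemma chart_open_image:
  assumes "is_chart X c" "openin X V" "V \<subseteq> fst c"
  shows "open (snd c ` V)"
proof -
  have "openin (subtopology X (fst c)) V"
    using assms by (simp add: is_chart_def openin_open_subtopology)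
  then have "openin (top_of_set (snd c ` fst c)) (snd c ` V)"
    using assms(1) homeomorphic_imp_open_map unfolding is_chart_def open_map_def by blast
  then show ?thesis
    using assms(1) by (auto simp: is_chart_def intro: openin_open_trans)
qed

lemma chart_open_preimage:
  assumes "is_chart X c" "open T"
  shows "openin X {x \<in> fst c. snd c x \<in> T}"
proof -
  have "continuous_map (subtopology X (fst c)) (top_of_set (snd c ` fst c)) (snd c)"
    using assms(1) by (simp add: is_chart_def homeomorphic_imp_continuous_map)
  moreover have "openin (top_of_set (snd c ` fst c)) (snd c ` fst c \<inter> T)"
    using assms(2) by (rule openin_open_Int)
  ultimately have "openin (subtopology X (fst c))
      {x \<in> topspace (subtopology X (fst c)). snd c x \<in> snd c ` fst c \<inter> T}"
    by (rule openin_continuous_map_preimage)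
  also have "{x \<in> topspace (subtopology X (fst c)). snd c x \<in> snd c ` fst c \<inter> T}
      = {x \<in> fst c. snd c x \<in> T}"
    using chart_subset[OF assms(1)] by auto
  finally show ?thesis
    using assms(1) by (metis is_chart_def openin_trans_full)
qed

definition smooth_map :: "('g, 'e::euclidean_space) lie_group \<Rightarrow> ('g \<Rightarrow> 'g) \<Rightarrow> bool" where
  "smooth_map G \<phi> \<longleftrightarrow> continuous_map (gtop G) (gtop G) \<phi> \<and>
     (\<forall>c\<in>atlas G. \<forall>c'\<in>atlas G.
        smooth_on (snd c ` {x \<in> fst c. \<phi> x \<in> fst c'}) (snd c' \<circ> \<phi> \<circ> chart_inv c))"

text \<open>All invariant objects below, namely the invariant fields, the metric and the adjoint action, come
  from left and right translations, whose smoothness is therefore recorded one translation at a time.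
  For a group of matrices the translations are restrictions of linear maps.\<close>

locale smooth_group = group G for G :: "('g, 'e::euclidean_space) lie_group" (structure) +
  assumes topspace_eq: "topspace (gtop G) = carrier G"
    and manifold: "smooth_manifold (gtop G) (atlas G)"
    and left_smooth: "h \<in> carrier G \<Longrightarrow> smooth_map G (\<lambda>x. h \<otimes> x)"
    and right_smooth: "h \<in> carrier G \<Longrightarrow> smooth_map G (\<lambda>x. x \<otimes> h)"
begin

lemma atlas_chart: "c \<in> atlas G \<Longrightarrow> is_chart (gtop G) c"
  using manifold by (simp add: smooth_manifold_def)

lemma chart_carrier: "c \<in> atlas G \<Longrightarrow> x \<in> fst c \<Longrightarrow> x \<in> carrier G"
  using chart_subset[OF atlas_chart] topspace_eq by blast

lemma chart_openin: "c \<in> atlas G \<Longrightarrow> openin (gtop G) (fst c)"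
  using atlas_chart is_chart_def by blast

lemma chart_cover:
  assumes "x \<in> carrier G" obtains c where "c \<in> atlas G" "x \<in> fst c"
  using manifold assms topspace_eq unfolding smooth_manifold_def by blast

lemma chart_left: "c \<in> atlas G \<Longrightarrow> x \<in> fst c \<Longrightarrow> chart_inv c (snd c x) = x"
  using chart_inv_left[OF atlas_chart] by blast

lemma open_chart_image: "c \<in> atlas G \<Longrightarrow> openin (gtop G) V \<Longrightarrow> V \<subseteq> fst c \<Longrightarrow> open (snd c ` V)"
  using chart_open_image[OF atlas_chart] by blast

lemma smooth_map_carrier: "smooth_map G \<phi> \<Longrightarrow> x \<in> carrier G \<Longrightarrow> \<phi> x \<in> carrier G"
  using topspace_eq continuous_map_image_subset_topspace[of "gtop G" "gtop G" \<phi>]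
  by (auto simp: smooth_map_def)

lemma openin_smooth_map_preimage:
  assumes "smooth_map G \<phi>" "openin (gtop G) U" "openin (gtop G) V"
  shows "openin (gtop G) {x \<in> U. \<phi> x \<in> V}"
proof -
  have "{x \<in> U. \<phi> x \<in> V} = U \<inter> {x \<in> topspace (gtop G). \<phi> x \<in> V}"
    using openin_subset[OF assms(2)] by auto
  then show ?thesis
    using assms openin_continuous_map_preimage[of "gtop G" "gtop G" \<phi> V]
    by (simp add: smooth_map_def openin_Int)
qed

text \<open>The identity is smooth because the transition maps of the atlas are. Changes of charts are
  thus covered by the statements about smooth maps, applied to the identity.\<close>

lemma smooth_map_id: "smooth_map G id"
proof -
  have "snd c ` {x \<in> fst c. id x \<in> fst c'} = snd c ` (fst c \<inter> fst c')"
    for c c' :: "('g, 'e) chart" by auto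
  then show ?thesis
    using manifold by (auto simp: smooth_map_def smooth_manifold_def)
qed

lemma smooth_near_cong:
  assumes "smooth_near G x f" "\<And>y. y \<in> carrier G \<Longrightarrow> f y = f' y"
  shows "smooth_near G x f'"
proof -
  obtain V where V: "openin (gtop G) V" "x \<in> V"
    and sm: "\<And>c. c \<in> atlas G \<Longrightarrow> smooth_on (snd c ` (fst c \<inter> V)) (f \<circ> chart_inv c)"
    using assms(1) by (auto simp: smooth_near_def)
  have "smooth_on (snd c ` (fst c \<inter> V)) (f' \<circ> chart_inv c)" if c: "c \<in> atlas G" for c
    using c assms(2) V(1)
    by (intro smooth_on_cong[OF _ sm[OF c]] open_chart_image openin_Int chart_openin)
       (auto simp: chart_left chart_carrier)
  with V show ?thesis by (auto simp: smooth_near_def)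
qed

text \<open>In each chart of the source, the composite factors through a chart of the target only piecewise,
  so smoothness is shown on the open pieces on which the map lands in a given chart.\<close>

lemma smooth_near_comp:
  assumes \<phi>: "smooth_map G \<phi>" and x: "x \<in> carrier G" and f: "smooth_near G (\<phi> x) f"
  shows "smooth_near G x (f \<circ> \<phi>)"
proof -
  obtain V where V: "openin (gtop G) V" "\<phi> x \<in> V"
    and sm: "\<And>c. c \<in> atlas G \<Longrightarrow> smooth_on (snd c ` (fst c \<inter> V)) (f \<circ> chart_inv c)"
    using f by (auto simp: smooth_near_def)
  define V' where "V' = {y \<in> carrier G. \<phi> y \<in> V}"
  have V': "openin (gtop G) V'"
    unfolding V'_def using openin_smooth_map_preimage[OF \<phi> openin_topspace V(1)] topspace_eq by simp
  have "smooth_on (snd c ` (fst c \<inter> V')) (f \<circ> \<phi> \<circ> chart_inv c)" if c: "c \<in> atlas G" for c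
  proof -
    define U where "U = (\<lambda>c' :: ('g, 'e) chart. {y \<in> fst c \<inter> V'. \<phi> y \<in> fst c'})"
    have opn: "open (snd c ` U c')" if "c' \<in> atlas G" for c'
      unfolding U_def using that c V'
      by (intro open_chart_image openin_smooth_map_preimage[OF \<phi>] openin_Int chart_openin) auto
    have "\<exists>c'\<in>atlas G. y \<in> U c'" if y: "y \<in> fst c \<inter> V'" for y
    proof -
      obtain c' where "c' \<in> atlas G" "\<phi> y \<in> fst c'"
        using chart_cover[OF smooth_map_carrier[OF \<phi> chart_carrier[OF c]]] y by blast
      with y show ?thesis by (auto simp: U_def)
    qed
    then have "fst c \<inter> V' = (\<Union>c'\<in>atlas G. U c')"
      by (auto simp: U_def)
    then have eq: "snd c ` (fst c \<inter> V') = \<Union>((\<lambda>c'. snd c ` U c') ` atlas G)" by auto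
    have "smooth_on (snd c ` U c') (f \<circ> \<phi> \<circ> chart_inv c)" if c': "c' \<in> atlas G" for c'
    proof (rule smooth_on_cong[OF opn[OF c']])
      have 1: "smooth_on (snd c ` U c') (snd c' \<circ> \<phi> \<circ> chart_inv c)"
      proof (rule smooth_on_subset)
        show "smooth_on (snd c ` {y \<in> fst c. \<phi> y \<in> fst c'}) (snd c' \<circ> \<phi> \<circ> chart_inv c)"
          using \<phi> c c' by (simp add: smooth_map_def)
      qed (auto simp: U_def)
      show "smooth_on (snd c ` U c')
          (\<lambda>a. (f \<circ> chart_inv c') ((snd c' \<circ> \<phi> \<circ> chart_inv c) a))"
        by (rule smooth_on_compose[OF opn[OF c'] _ 1 sm[OF c']])
           (use c in \<open>auto simp: U_def V'_def chart_left\<close>)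
      show "(f \<circ> chart_inv c') ((snd c' \<circ> \<phi> \<circ> chart_inv c) a) = (f \<circ> \<phi> \<circ> chart_inv c) a"
        if "a \<in> snd c ` U c'" for a
        using that c c' by (auto simp: U_def chart_left)
    qed
    then show ?thesis
      unfolding eq using opn by (intro smooth_on_Union) auto
  qed
  moreover have "x \<in> V'" using x V(2) by (simp add: V'_def)
  ultimately show ?thesis using V' unfolding smooth_near_def by blast
qed

lemma smooth_near_differentiable:
  assumes "smooth_near G x f" "c \<in> atlas G" "x \<in> fst c"
  shows "(f \<circ> chart_inv c) differentiable (at (snd c x))"
  using assms unfolding smooth_near_def by (meson IntI imageI smooth_on_imp_differentiable)

lemma coord_vec_add:
  assumes "c \<in> atlas G" "x \<in> fst c"
  shows "coord_vec G c x (a + b) = coord_vec G c x a + coord_vec G c x b"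
  using linear_add[OF linear_frechet_derivative[OF smooth_near_differentiable[OF _ assms]]]
  by (auto simp: coord_vec_def fun_eq_iff)

lemma coord_vec_scale:
  assumes "c \<in> atlas G" "x \<in> fst c"
  shows "coord_vec G c x (r *\<^sub>R a) = r *\<^sub>R coord_vec G c x a"
  using linear_scale[OF linear_frechet_derivative[OF smooth_near_differentiable[OF _ assms]]]
  by (auto simp: coord_vec_def fun_eq_iff scaleR_fun_def)

text \<open>This is the chain rule. The inverse map is required because tangent vectors are extended by 0 to
  functions that are not smooth near the base point: both sides must vanish on the same functions.\<close>

lemma push_coord_vec:
  assumes \<phi>: "smooth_map G \<phi>" and \<psi>: "smooth_map G \<psi>"
    and inverse: "\<And>x. x \<in> carrier G \<Longrightarrow> \<psi> (\<phi> x) = x" "\<And>x. x \<in> carrier G \<Longrightarrow> \<phi> (\<psi> x) = x"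
    and c: "c \<in> atlas G" "x \<in> fst c" and c': "c' \<in> atlas G" "\<phi> x \<in> fst c'"
  shows "push \<phi> (coord_vec G c x a) =
    coord_vec G c' (\<phi> x) (frechet_derivative (snd c' \<circ> \<phi> \<circ> chart_inv c) (at (snd c x)) a)"
proof
  fix f
  have x: "x \<in> carrier G" using c chart_carrier by blast
  have iff: "smooth_near G x (f \<circ> \<phi>) \<longleftrightarrow> smooth_near G (\<phi> x) f"
  proof
    assume "smooth_near G x (f \<circ> \<phi>)"
    then have "smooth_near G (\<phi> x) ((f \<circ> \<phi>) \<circ> \<psi>)"
      using smooth_near_comp[OF \<psi>] smooth_map_carrier[OF \<phi> x] inverse(1)[OF x] by simp
    then show "smooth_near G (\<phi> x) f"
      by (rule smooth_near_cong) (simp add: inverse)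
  qed (rule smooth_near_comp[OF \<phi> x])
  have "frechet_derivative (f \<circ> \<phi> \<circ> chart_inv c) (at (snd c x)) =
      frechet_derivative (f \<circ> chart_inv c') (at (snd c' (\<phi> x))) \<circ>
      frechet_derivative (snd c' \<circ> \<phi> \<circ> chart_inv c) (at (snd c x))"
    if f: "smooth_near G (\<phi> x) f"
  proof -
    let ?U = "{y \<in> fst c. \<phi> y \<in> fst c'}" and ?F = "snd c' \<circ> \<phi> \<circ> chart_inv c"
    have opn: "open (snd c ` ?U)"
      using c c' by (intro open_chart_image openin_smooth_map_preimage[OF \<phi>] chart_openin) auto
    have mem: "snd c x \<in> snd c ` ?U" using c c' by simp
    have F: "?F differentiable (at (snd c x))"
      using smooth_on_imp_differentiable[OF _ mem] \<phi> c c' by (auto simp: smooth_map_def)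
    have Fx: "?F (snd c x) = snd c' (\<phi> x)" using c by (simp add: chart_left)
    have f': "(f \<circ> chart_inv c') differentiable (at (?F (snd c x)))"
      unfolding Fx by (rule smooth_near_differentiable[OF f c'])
    have "((f \<circ> chart_inv c') \<circ> ?F) differentiable (at (snd c x))"
      by (rule differentiable_chain_at[OF F f'])
    then have "frechet_derivative (f \<circ> \<phi> \<circ> chart_inv c) (at (snd c x)) =
        frechet_derivative ((f \<circ> chart_inv c') \<circ> ?F) (at (snd c x))"
      using c c'
      by (intro frechet_derivative_transform_within_open[OF _ opn mem, symmetric])
         (auto simp: chart_left)
    then show ?thesis
      by (rule trans) (rule frechet_derivative_compose[OF F f', unfolded Fx])
  qed
  then show "push \<phi> (coord_vec G c x a) f =
      coord_vec G c' (\<phi> x) (frechet_derivative (snd c' \<circ> \<phi> \<circ> chart_inv c) (at (snd c x)) a) f"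
    using iff by (simp add: push_def coord_vec_def)
qed

lemma tangent_space_eq_range:
  assumes "c \<in> atlas G" "x \<in> fst c"
  shows "tangent_space G x = range (coord_vec G c x)"
proof -
  have "coord_vec G c' x a \<in> range (coord_vec G c x)" if "c' \<in> atlas G" "x \<in> fst c'" for c' a
    using push_coord_vec[OF smooth_map_id smooth_map_id, of c' x c a] that assms
    by (auto simp: push_def)
  then have "tangent_space G x \<subseteq> range (coord_vec G c x)"
    unfolding tangent_space_def by blast
  moreover have "range (coord_vec G c x) \<subseteq> tangent_space G x"
    unfolding tangent_space_def using assms by blast
  ultimately show ?thesis by (rule antisym)
qed

lemma subspace_tangent_space:
  assumes "x \<in> carrier G" shows "subspace (tangent_space G x)"
proof -
  obtain c where c: "c \<in> atlas G" "x \<in> fst c" using chart_cover[OF assms] .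
  have "linear (coord_vec G c x)"
    using coord_vec_add[OF c] coord_vec_scale[OF c] by (intro linearI)
  then show ?thesis
    unfolding tangent_space_eq_range[OF c] by (rule linear_subspace_image) simp
qed

lemma push_tangent_space:
  assumes "smooth_map G \<phi>" "smooth_map G \<psi>"
    "\<And>x. x \<in> carrier G \<Longrightarrow> \<psi> (\<phi> x) = x" "\<And>x. x \<in> carrier G \<Longrightarrow> \<phi> (\<psi> x) = x"
    and x: "x \<in> carrier G" and v: "v \<in> tangent_space G x"
  shows "push \<phi> v \<in> tangent_space G (\<phi> x)"
proof -
  obtain c a where c: "c \<in> atlas G" "x \<in> fst c" and v: "v = coord_vec G c x a"
    using v by (auto simp: tangent_space_def)
  obtain c' where c': "c' \<in> atlas G" "\<phi> x \<in> fst c'"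
    using chart_cover[OF smooth_map_carrier[OF assms(1) x]] .
  have "push \<phi> v = coord_vec G c' (\<phi> x)
      (frechet_derivative (snd c' \<circ> \<phi> \<circ> chart_inv c) (at (snd c x)) a)"
    unfolding v by (rule push_coord_vec[OF assms(1,2) _ _ c c']) (simp_all add: assms(3,4))
  then show ?thesis unfolding tangent_space_eq_range[OF c'] by (rule range_eqI)
qed

text \<open>A tangent vector is a functional on functions defined on the whole type, whereas group laws
  such as associativity hold on the carrier. This lemma bridges the two.\<close>

lemma tangent_vec_cong:
  assumes v: "v \<in> tangent_space G x" and eq: "\<And>y. y \<in> carrier G \<Longrightarrow> f y = f' y"
  shows "v f = v f'"
proof -
  obtain c a where c: "c \<in> atlas G" "x \<in> fst c" and v: "v = coord_vec G c x a"
    using v by (auto simp: tangent_space_def)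
  have "smooth_near G x f \<longleftrightarrow> smooth_near G x f'"
    using smooth_near_cong eq by metis
  moreover have "frechet_derivative (f \<circ> chart_inv c) (at (snd c x)) =
      frechet_derivative (f' \<circ> chart_inv c) (at (snd c x))" if "smooth_near G x f"
    using c eq by (intro frechet_derivative_transform_within_open[OF
        smooth_near_differentiable[OF that c], of "snd c ` fst c"] open_chart_image chart_openin)
       (auto simp: chart_left chart_carrier)
  ultimately show ?thesis by (simp add: v coord_vec_def)
qed

lemma push_cong:
  assumes "v \<in> tangent_space G x" "\<And>y. y \<in> carrier G \<Longrightarrow> \<phi> y = \<phi>' y"
  shows "push \<phi> v = push \<phi>' v"
  unfolding push_def by (intro ext tangent_vec_cong[OF assms(1)]) (simp add: assms(2))

lemma smooth_near_coordinate:
  assumes c: "c \<in> atlas G" and x: "x \<in> fst c"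
  shows "smooth_near G x (\<lambda>y. snd c y \<bullet> b)"
proof -
  have "smooth_on (snd c' ` (fst c' \<inter> fst c)) (\<lambda>a. (snd c \<circ> chart_inv c') a \<bullet> b)"
    if c': "c' \<in> atlas G" for c'
  proof (rule smooth_on_linear[OF bounded_linear_inner_left])
    show "open (snd c' ` (fst c' \<inter> fst c))"
      using c c' by (intro open_chart_image chart_openin openin_Int) auto
    show "smooth_on (snd c' ` (fst c' \<inter> fst c)) (snd c \<circ> chart_inv c')"
      using manifold c c' by (simp add: smooth_manifold_def)
  qed
  with x chart_openin[OF c] show ?thesis
    unfolding smooth_near_def by (auto simp: o_def)
qed

lemma coord_vec_coordinate:
  assumes c: "c \<in> atlas G" and x: "x \<in> fst c"
  shows "coord_vec G c x a (\<lambda>y. snd c y \<bullet> b) = a \<bullet> b"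
proof -
  have "((\<lambda>y. snd c y \<bullet> b) \<circ> chart_inv c has_derivative (\<lambda>a. a \<bullet> b)) (at (snd c x))"
  proof (rule has_derivative_transform_within_open)
    show "((\<lambda>a. a \<bullet> b) has_derivative (\<lambda>a. a \<bullet> b)) (at (snd c x))"
      by (intro bounded_linear_imp_has_derivative bounded_linear_inner_left)
    show "open (snd c ` fst c)" using c by (intro open_chart_image chart_openin) auto
  qed (use c x in \<open>auto simp: chart_left\<close>)
  then have "frechet_derivative ((\<lambda>y. snd c y \<bullet> b) \<circ> chart_inv c) (at (snd c x)) = (\<lambda>a. a \<bullet> b)"
    by (metis frechet_derivative_at)
  then show ?thesis by (simp add: coord_vec_def smooth_near_coordinate[OF c x])
qed

text \<open>The tangent vector of a curve has the derivative of the coordinates of the curve as its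
  coordinates.\<close>

lemma velocity_eq_coord_vec:
  assumes c: "c \<in> atlas G" and I: "open I" "s \<in> I" "\<And>t. t \<in> I \<Longrightarrow> x t \<in> fst c"
    and diff: "((\<lambda>t. snd c (x t)) has_vector_derivative w) (at s)"
  shows "velocity G x s = coord_vec G c (x s) w"
proof
  fix f
  have "deriv (f \<circ> x) s = frechet_derivative (f \<circ> chart_inv c) (at (snd c (x s))) w"
    if f: "smooth_near G (x s) f"
  proof -
    let ?D = "frechet_derivative (f \<circ> chart_inv c) (at (snd c (x s)))"
    have f': "(f \<circ> chart_inv c has_derivative ?D) (at (snd c (x s)))"
      using smooth_near_differentiable[OF f c] I by (simp add: frechet_derivative_works)
    from vector_derivative_diff_chain_within[OF diff, of "f \<circ> chart_inv c" ?D]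
    have "(((f \<circ> chart_inv c) \<circ> (\<lambda>t. snd c (x t))) has_vector_derivative ?D w) (at s)"
      using has_derivative_at_withinI[OF f'] by blast
    then have "((f \<circ> x) has_vector_derivative ?D w) (at s)"
      by (rule has_vector_derivative_transform_within_open[OF _ I(1,2)])
         (use I c in \<open>auto simp: chart_left\<close>)
    then show ?thesis
      by (simp add: DERIV_imp_deriv has_real_derivative_iff_has_vector_derivative)
  qed
  then show "velocity G x s f = coord_vec G c (x s) w f"
    by (simp add: velocity_def coord_vec_def)
qed

end

lemma push_push: "push \<phi> (push \<psi> v) = push (\<lambda>y. \<phi> (\<psi> y)) v"
  by (simp add: push_def o_def)

lemma push_add: "push \<phi> (v + w) = push \<phi> v + push \<phi> w"
  and push_scale: "push \<phi> (r *\<^sub>R v) = r *\<^sub>R push \<phi> v"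
  by (simp_all add: push_def fun_eq_iff scaleR_fun_def)

text \<open>Fixing one argument of the smooth multiplication gives a smooth translation; in charts this is
  composition with the embedding of a slice of the product.\<close>

lemma lie_group_imp_smooth_group:
  assumes "is_lie_group G" shows "smooth_group G"
proof -
  interpret group G using assms by (simp add: is_lie_group_def)
  have top: "topspace (gtop G) = carrier G" and man: "smooth_manifold (gtop G) (atlas G)"
    and cont: "continuous_map (prod_topology (gtop G) (gtop G)) (gtop G) (\<lambda>(x, y). x \<otimes>\<^bsub>G\<^esub> y)"
    and mult: "\<And>c c' c''. \<lbrakk>c \<in> atlas G; c' \<in> atlas G; c'' \<in> atlas G\<rbrakk> \<Longrightarrow>
        smooth_on {(a, b). a \<in> snd c ` fst c \<and> b \<in> snd c' ` fst c' \<and>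
                           chart_inv c a \<otimes>\<^bsub>G\<^esub> chart_inv c' b \<in> fst c''}
          (\<lambda>(a, b). snd c'' (chart_inv c a \<otimes>\<^bsub>G\<^esub> chart_inv c' b))"
    using assms by (simp_all add: is_lie_group_def)
  have chart: "is_chart (gtop G) c" if "c \<in> atlas G" for c
    using that man by (simp add: smooth_manifold_def)
  have "smooth_map G (\<lambda>x. h \<otimes>\<^bsub>G\<^esub> x) \<and> smooth_map G (\<lambda>x. x \<otimes>\<^bsub>G\<^esub> h)" if h: "h \<in> carrier G" for h
  proof -
    obtain c0 where c0: "c0 \<in> atlas G" "h \<in> fst c0"
      using h man top unfolding smooth_manifold_def by blast
    have ch: "chart_inv c0 (snd c0 h) = h" using chart_inv_left[OF chart] c0 by blast
    have contL: "continuous_map (gtop G) (gtop G) (\<lambda>x. h \<otimes>\<^bsub>G\<^esub> x)"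
      using continuous_map_compose[OF _ cont, of "gtop G" "\<lambda>x. (h, x)"] h top
      by (simp add: o_def continuous_map_pairwise)
    have contR: "continuous_map (gtop G) (gtop G) (\<lambda>x. x \<otimes>\<^bsub>G\<^esub> h)"
      using continuous_map_compose[OF _ cont, of "gtop G" "\<lambda>x. (x, h)"] h top
      by (simp add: o_def continuous_map_pairwise)
    have opn: "open (snd c ` {x \<in> fst c. \<phi> x \<in> fst c'})"
      if c: "c \<in> atlas G" and c': "c' \<in> atlas G" and "continuous_map (gtop G) (gtop G) \<phi>" for c c' \<phi>
    proof (rule chart_open_image[OF chart[OF c]])
      have "{x \<in> fst c. \<phi> x \<in> fst c'} = fst c \<inter> {x \<in> topspace (gtop G). \<phi> x \<in> fst c'}"
        using chart_subset[OF chart[OF c]] by auto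
      then show "openin (gtop G) {x \<in> fst c. \<phi> x \<in> fst c'}"
        using chart[OF c] chart[OF c'] openin_continuous_map_preimage[OF that(3)]
        by (simp add: is_chart_def openin_Int)
    qed auto
    have pairL: "smooth_on U (\<lambda>a. (b, a))" and pairR: "smooth_on U (\<lambda>a. (a, b))"
      if "open U" for U :: "'b set" and b :: 'b
    proof -
      have "smooth_on U (\<lambda>a. (b, 0) + (0, a))" "smooth_on U (\<lambda>a. (0, b) + (a, 0))"
        using that by (intro smooth_on_add smooth_on_const
            smooth_on_subset[OF smooth_on_bounded_linear] bounded_linear_Pair
            bounded_linear_zero bounded_linear_ident; simp)+
      then show "smooth_on U (\<lambda>a. (b, a))" "smooth_on U (\<lambda>a. (a, b))" by simp_all
    qed
    have "smooth_on (snd c ` {x \<in> fst c. h \<otimes>\<^bsub>G\<^esub> x \<in> fst c'})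
          (snd c' \<circ> (\<lambda>x. h \<otimes>\<^bsub>G\<^esub> x) \<circ> chart_inv c)"
      and "smooth_on (snd c ` {x \<in> fst c. x \<otimes>\<^bsub>G\<^esub> h \<in> fst c'})
          (snd c' \<circ> (\<lambda>x. x \<otimes>\<^bsub>G\<^esub> h) \<circ> chart_inv c)"
      if c: "c \<in> atlas G" and c': "c' \<in> atlas G" for c c'
    proof -
      have inv: "chart_inv c (snd c x) = x" if "x \<in> fst c" for x
        using chart_inv_left[OF chart[OF c] that] .
      show "smooth_on (snd c ` {x \<in> fst c. h \<otimes>\<^bsub>G\<^esub> x \<in> fst c'})
          (snd c' \<circ> (\<lambda>x. h \<otimes>\<^bsub>G\<^esub> x) \<circ> chart_inv c)"
        using smooth_on_compose[OF opn[OF c c' contL] _ pairL[OF opn[OF c c' contL], of "snd c0 h"]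
            mult[OF c0(1) c c']] c0 ch inv by (auto simp: o_def image_subset_iff)
      show "smooth_on (snd c ` {x \<in> fst c. x \<otimes>\<^bsub>G\<^esub> h \<in> fst c'})
          (snd c' \<circ> (\<lambda>x. x \<otimes>\<^bsub>G\<^esub> h) \<circ> chart_inv c)"
        using smooth_on_compose[OF opn[OF c c' contR] _ pairR[OF opn[OF c c' contR], of "snd c0 h"]
            mult[OF c c0(1) c']] c0 ch inv by (auto simp: o_def image_subset_iff)
    qed
    with contL contR show ?thesis by (simp add: smooth_map_def)
  qed
  with top man show ?thesis by unfold_locales auto
qed

section \<open>Translations and the left trivialization of the tangent bundle\<close>

context smooth_group
begin

lemma left_push_tangent:
  assumes "h \<in> carrier G" "x \<in> carrier G" "v \<in> tangent_space G x"
  shows "push (\<lambda>y. h \<otimes> y) v \<in> tangent_space G (h \<otimes> x)"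
  using assms
  by (intro push_tangent_space[OF left_smooth left_smooth[of "inv h"]]) (auto simp flip: m_assoc)

lemma right_push_tangent:
  assumes "h \<in> carrier G" "x \<in> carrier G" "v \<in> tangent_space G x"
  shows "push (\<lambda>y. y \<otimes> h) v \<in> tangent_space G (x \<otimes> h)"
  using assms
  by (intro push_tangent_space[OF right_smooth right_smooth[of "inv h"]]) (auto simp: m_assoc)

lemma push_ident: "push (\<lambda>y. y) v = v"
  by (simp add: push_def o_def)

lemma left_field_tangent:
  "x \<in> carrier G \<Longrightarrow> y \<in> lie_algebra G \<Longrightarrow> left_field G y x \<in> tangent_space G x"
  using left_push_tangent[of x "\<one>" y] by (simp add: left_field_def lie_algebra_def)

lemma right_field_tangent:
  "x \<in> carrier G \<Longrightarrow> y \<in> lie_algebra G \<Longrightarrow> right_field G y x \<in> tangent_space G x"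
  using right_push_tangent[of x "\<one>" y] by (simp add: right_field_def lie_algebra_def)

text \<open>This is the left Maurer--Cartan form. The metric is the pullback of the form on the Lie algebra
  along it.\<close>

definition to_identity :: "'g \<Rightarrow> 'g tvec \<Rightarrow> 'g tvec" where
  "to_identity x v = push (\<lambda>y. inv x \<otimes> y) v"

lemma to_identity_lie_algebra:
  "x \<in> carrier G \<Longrightarrow> v \<in> tangent_space G x \<Longrightarrow> to_identity x v \<in> lie_algebra G"
  using left_push_tangent[of "inv x" x v] by (simp add: to_identity_def lie_algebra_def)

lemma to_identity_left_field:
  assumes "x \<in> carrier G" "y \<in> lie_algebra G"
  shows "to_identity x (left_field G y x) = y"
proof -
  have "push (\<lambda>w. inv x \<otimes> (x \<otimes> w)) y = push (\<lambda>w. w) y"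
    using assms by (intro push_cong[of _ \<one>]) (auto simp: lie_algebra_def simp flip: m_assoc)
  then show ?thesis by (simp add: to_identity_def left_field_def push_push push_ident)
qed

lemma left_field_to_identity:
  assumes "x \<in> carrier G" "v \<in> tangent_space G x"
  shows "left_field G (to_identity x v) x = v"
proof -
  have "push (\<lambda>w. x \<otimes> (inv x \<otimes> w)) v = push (\<lambda>w. w) v"
    using assms by (intro push_cong[of _ x]) (auto simp flip: m_assoc)
  then show ?thesis by (simp add: to_identity_def left_field_def push_push push_ident)
qed

text \<open>Seen in the left trivialization, right-invariant fields are twisted by the adjoint action. This
  is how the invariance of the form will enter.\<close>

lemma to_identity_right_field:
  assumes "x \<in> carrier G" "y \<in> lie_algebra G"
  shows "to_identity x (right_field G y x) = adjoint G (inv x) y"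
  unfolding to_identity_def right_field_def push_push adjoint_def
  using assms by (intro push_cong[of _ \<one>]) (auto simp: lie_algebra_def m_assoc)

lemma adjoint_lie_algebra:
  assumes h: "h \<in> carrier G" and y: "y \<in> lie_algebra G"
  shows "adjoint G h y \<in> lie_algebra G"
proof -
  have "to_identity (inv h) (right_field G y (inv h)) \<in> lie_algebra G"
    using h y by (intro to_identity_lie_algebra right_field_tangent) auto
  then show ?thesis using h y by (simp add: to_identity_right_field)
qed

lemma adjoint_adjoint_inv:
  assumes h: "h \<in> carrier G" and y: "y \<in> lie_algebra G"
  shows "adjoint G h (adjoint G (inv h) y) = y"
proof -
  have "push (\<lambda>w. h \<otimes> (inv h \<otimes> w \<otimes> inv (inv h)) \<otimes> inv h) y = push (\<lambda>w. w) y"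
    using assms
    by (intro push_cong[of _ \<one>]) (auto simp: lie_algebra_def m_assoc simp flip: m_assoc[of h])
  then show ?thesis by (simp add: adjoint_def push_push push_ident)
qed

lemma subspace_lie_algebra: "subspace (lie_algebra G)"
  by (simp add: lie_algebra_def subspace_tangent_space)

end

section \<open>Invariant forms and the Sugawara elements\<close>

text \<open>Covectors are turned into vectors through expansions in the dual bases.\<close>

locale metric_group = smooth_group G for G :: "('g, 'e::euclidean_space) lie_group" (structure) +
  fixes g :: "'g tvec \<Rightarrow> 'g tvec \<Rightarrow> real" and d :: nat and e e' :: "nat \<Rightarrow> 'g tvec"
  assumes invariant: "invariant_form G g" and dual: "dual_bases G g d e e'"
begin

lemmas lie_closed [simp, intro] =
  subspace_add[OF subspace_lie_algebra] subspace_scale[OF subspace_lie_algebra]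
  subspace_neg[OF subspace_lie_algebra] subspace_0[OF subspace_lie_algebra]

lemmas form_axioms = invariant[unfolded invariant_form_def]
lemmas form_add = form_axioms[THEN conjunct1, rule_format]
lemmas form_scale = form_axioms[THEN conjunct2, THEN conjunct1, rule_format]
lemmas form_sym = form_axioms[THEN conjunct2, THEN conjunct2, THEN conjunct1, rule_format]
lemmas form_nondegenerate =
  form_axioms[THEN conjunct2, THEN conjunct2, THEN conjunct2, THEN conjunct1, rule_format]
lemmas form_adjoint =
  form_axioms[THEN conjunct2, THEN conjunct2, THEN conjunct2, THEN conjunct2, rule_format]

lemma form_add_right: "x \<in> lie_algebra G \<Longrightarrow> y \<in> lie_algebra G \<Longrightarrow> z \<in> lie_algebra G \<Longrightarrow>
    g z (x + y) = g z x + g z y"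
  using form_add form_sym lie_closed(1) by metis

lemma form_scale_right: "x \<in> lie_algebra G \<Longrightarrow> y \<in> lie_algebra G \<Longrightarrow> g x (r *\<^sub>R y) = r * g x y"
  using form_scale form_sym lie_closed(2) by metis

lemma basis_lie_algebra: "a < d \<Longrightarrow> e a \<in> lie_algebra G" "a < d \<Longrightarrow> e' a \<in> lie_algebra G"
proof -
  have "span (e ` {..<d}) = lie_algebra G" "span (e' ` {..<d}) = lie_algebra G"
    using dual by (simp_all add: dual_bases_def)
  then show "a < d \<Longrightarrow> e a \<in> lie_algebra G" "a < d \<Longrightarrow> e' a \<in> lie_algebra G"
    using span_base[of "e a" "e ` {..<d}"] span_base[of "e' a" "e' ` {..<d}"] by auto
qed

text \<open>Linearity holds on the Lie algebra only; outside it the values of a form are arbitrary.\<close>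

lemma linear_on_lie_algebra_sum:
  fixes P :: "'g tvec \<Rightarrow> real"
  assumes "\<And>x y. x \<in> lie_algebra G \<Longrightarrow> y \<in> lie_algebra G \<Longrightarrow> P (x + y) = P x + P y"
    and "\<And>x r. x \<in> lie_algebra G \<Longrightarrow> P (r *\<^sub>R x) = r * P x"
    and "finite A" "\<And>a. a \<in> A \<Longrightarrow> v a \<in> lie_algebra G"
  shows "P (\<Sum>a\<in>A. c a *\<^sub>R v a) = (\<Sum>a\<in>A. c a * P (v a))"
  using assms(3,4)
proof (induction A)
  case empty
  show ?case
    using assms(2)[OF lie_closed(4), of 0]
    by (simp only: sum.empty scaleR_zero_left mult_zero_left)
next
  case (insert a A)
  then have "(\<Sum>a\<in>A. c a *\<^sub>R v a) \<in> lie_algebra G" and a: "v a \<in> lie_algebra G"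
    by (auto intro: subspace_sum[OF subspace_lie_algebra])
  then have "P (c a *\<^sub>R v a + (\<Sum>a\<in>A. c a *\<^sub>R v a)) =
      c a * P (v a) + P (\<Sum>a\<in>A. c a *\<^sub>R v a)"
    by (simp only: assms(1)[OF lie_closed(2)[OF a]] assms(2)[OF a])
  moreover have "P (\<Sum>a\<in>A. c a *\<^sub>R v a) = (\<Sum>a\<in>A. c a * P (v a))"
    using insert.IH insert.prems by blast
  ultimately show ?case by (simp only: sum.insert[OF insert.hyps(1,2)])
qed

lemma dual_basis_expansion:
  assumes u: "u \<in> lie_algebra G" shows "u = (\<Sum>a<d. g u (e' a) *\<^sub>R e a)"
proof -
  have "inj_on e {..<d}" "u \<in> span (e ` {..<d})"
    and eq: "\<And>a b. a < d \<Longrightarrow> b < d \<Longrightarrow> g (e a) (e' b) = (if a = b then 1 else 0)"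
    using dual u by (auto simp: dual_bases_def)
  then obtain c where "u = (\<Sum>v\<in>e ` {..<d}. c v *\<^sub>R v)"
    using span_finite[of "e ` {..<d}"] by auto
  then have u: "u = (\<Sum>a<d. c (e a) *\<^sub>R e a)"
    using \<open>inj_on e {..<d}\<close> by (simp add: sum.reindex)
  have "g u (e' b) = c (e b)" if "b < d" for b
  proof -
    have "g u (e' b) = (\<Sum>a<d. c (e a) * g (e a) (e' b))"
      unfolding u using that basis_lie_algebra
      by (intro linear_on_lie_algebra_sum[of "\<lambda>x. g x (e' b)"]) (auto simp: form_add form_scale)
    also have "\<dots> = (\<Sum>a<d. if a = b then c (e a) else 0)"
      using that eq by (intro sum.cong) auto
    finally show ?thesis using that by simp
  qed
  then have "(\<Sum>a<d. g u (e' a) *\<^sub>R e a) = (\<Sum>a<d. c (e a) *\<^sub>R e a)"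
    by (intro sum.cong) auto
  then show ?thesis using u by simp
qed

lemma functional_expansion:
  fixes P :: "'g tvec \<Rightarrow> real"
  assumes "\<And>x y. x \<in> lie_algebra G \<Longrightarrow> y \<in> lie_algebra G \<Longrightarrow> P (x + y) = P x + P y"
    and "\<And>x r. x \<in> lie_algebra G \<Longrightarrow> P (r *\<^sub>R x) = r * P x" and "u \<in> lie_algebra G"
  shows "P u = (\<Sum>a<d. g u (e' a) * P (e a))"
proof -
  have "P (\<Sum>a<d. g u (e' a) *\<^sub>R e a) = (\<Sum>a<d. g u (e' a) * P (e a))"
    by (rule linear_on_lie_algebra_sum[OF assms(1,2)]) (simp_all add: basis_lie_algebra)
  then show ?thesis using dual_basis_expansion[OF assms(3)] by metis
qed

text \<open>Contraction of a vector with the pair of dual bases: the reason why a Sugawara element is a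
  square length.\<close>

lemma form_contraction:
  assumes u: "u \<in> lie_algebra G" shows "(\<Sum>a<d. g u (e a) * g u (e' a)) = g u u"
proof -
  have "g u u = (\<Sum>a<d. g u (e' a) * g u (e a))"
    by (rule functional_expansion[of "g u"]) (auto simp: u form_add_right form_scale_right)
  then show ?thesis by (simp add: mult.commute)
qed

lemma form_represents:
  fixes P :: "'g tvec \<Rightarrow> real"
  assumes "\<And>x y. x \<in> lie_algebra G \<Longrightarrow> y \<in> lie_algebra G \<Longrightarrow> P (x + y) = P x + P y"
    and "\<And>x r. x \<in> lie_algebra G \<Longrightarrow> P (r *\<^sub>R x) = r * P x"
  obtains v where "v \<in> lie_algebra G" "\<And>y. y \<in> lie_algebra G \<Longrightarrow> g v y = P y"
proof
  let ?v = "\<Sum>a<d. P (e a) *\<^sub>R e' a"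
  show "?v \<in> lie_algebra G"
    by (intro subspace_sum[OF subspace_lie_algebra]) (auto simp: basis_lie_algebra)
  fix y assume y: "y \<in> lie_algebra G"
  have "g ?v y = (\<Sum>a<d. P (e a) * g (e' a) y)"
    by (rule linear_on_lie_algebra_sum[of "\<lambda>x. g x y"]) (auto simp: y basis_lie_algebra form_add form_scale)
  also have "\<dots> = (\<Sum>a<d. g y (e' a) * P (e a))"
    using y basis_lie_algebra form_sym by (intro sum.cong) auto
  also have "\<dots> = P y" by (rule functional_expansion[OF assms y, symmetric])
  finally show "g ?v y = P y" .
qed

lemma metric_eq: "metric G g x v w = g (to_identity x v) (to_identity x w)"
  by (simp add: metric_def to_identity_def)

lemma cotangent_add: "p \<in> cotangent_space G x \<Longrightarrow> v \<in> tangent_space G x \<Longrightarrow>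
    w \<in> tangent_space G x \<Longrightarrow> p (v + w) = p v + p w"
  and cotangent_scale: "p \<in> cotangent_space G x \<Longrightarrow> v \<in> tangent_space G x \<Longrightarrow> p (r *\<^sub>R v) = r * p v"
  by (simp_all add: cotangent_space_def)

lemma sharp_eqI:
  assumes x: "x \<in> carrier G" and v: "v \<in> tangent_space G x"
    and p: "\<And>w. w \<in> tangent_space G x \<Longrightarrow> metric G g x v w = p w"
  shows "sharp G g x p = v"
  unfolding sharp_def
proof (rule the_equality)
  fix v' assume v': "v' \<in> tangent_space G x \<and> (\<forall>w\<in>tangent_space G x. metric G g x v' w = p w)"
  let ?u = "to_identity x v" and ?u' = "to_identity x v'"
  have u: "?u \<in> lie_algebra G" "?u' \<in> lie_algebra G"
    using to_identity_lie_algebra x v v' by auto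
  have "?u' + (-1) *\<^sub>R ?u = 0"
  proof (rule form_nondegenerate)
    fix y assume y: "y \<in> lie_algebra G"
    have "g ?u y = p (left_field G y x)" "g ?u' y = p (left_field G y x)"
      using p[OF left_field_tangent[OF x y]] v' left_field_tangent[OF x y]
      unfolding metric_eq to_identity_left_field[OF x y] by (blast, metis to_identity_left_field x y)
    then show "g (?u' + (-1) *\<^sub>R ?u) y = 0"
      unfolding form_add[OF u(2) lie_closed(2)[OF u(1)] y] form_scale[OF u(1) y] by simp
  qed (use u in blast)
  then have "?u' = ?u" by simp
  then show "v' = v" using left_field_to_identity[OF x] v v' by metis
qed (use v p in auto)

lemma sharp:
  assumes x: "x \<in> carrier G" and p: "p \<in> cotangent_space G x"
  shows "sharp G g x p \<in> tangent_space G x"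
    and "w \<in> tangent_space G x \<Longrightarrow> metric G g x (sharp G g x p) w = p w"
proof -
  have "left_field G (y + z) x = left_field G y x + left_field G z x"
    "left_field G (r *\<^sub>R y) x = r *\<^sub>R left_field G y x" for y z r
    by (simp_all add: left_field_def push_add push_scale)
  then obtain v where v: "v \<in> lie_algebra G"
      "\<And>y. y \<in> lie_algebra G \<Longrightarrow> g v y = p (left_field G y x)"
    using form_represents[of "\<lambda>y. p (left_field G y x)"] cotangent_add[OF p] cotangent_scale[OF p]
      left_field_tangent[OF x] by metis
  let ?w = "left_field G v x"
  have w: "?w \<in> tangent_space G x" using left_field_tangent[OF x v(1)] .
  have m: "metric G g x ?w w = p w" if "w \<in> tangent_space G x" for w
    using v x that left_field_to_identity[OF x that] to_identity_lie_algebra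
    by (simp add: metric_eq to_identity_left_field)
  have "sharp G g x p = ?w" by (rule sharp_eqI[OF x w m])
  with w m show "sharp G g x p \<in> tangent_space G x"
    "w \<in> tangent_space G x \<Longrightarrow> metric G g x (sharp G g x p) w = p w" by auto
qed

lemma to_identity_linear:
  "to_identity x (v + w) = to_identity x v + to_identity x w"
  "to_identity x (r *\<^sub>R v) = r *\<^sub>R to_identity x v"
  by (simp_all add: to_identity_def push_add push_scale)

lemma inverse_metric_scale:
  assumes x: "x \<in> carrier G" and p: "p \<in> cotangent_space G x"
  shows "inverse_metric G g x (r *\<^sub>R p) (r *\<^sub>R p) = r\<^sup>2 * inverse_metric G g x p p"
proof -
  have rp: "(r *\<^sub>R p) w = r * p w" for w
    by (simp add: scaleR_fun_def)
  have "sharp G g x (r *\<^sub>R p) = r *\<^sub>R sharp G g x p"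
  proof (rule sharp_eqI[OF x])
    show "r *\<^sub>R sharp G g x p \<in> tangent_space G x"
      using sharp(1)[OF x p] subspace_tangent_space[OF x] by (rule subspace_scale[rotated])
    fix w assume w: "w \<in> tangent_space G x"
    then show "metric G g x (r *\<^sub>R sharp G g x p) w = (r *\<^sub>R p) w"
      using sharp[OF x p] to_identity_lie_algebra[OF x]
      unfolding rp metric_eq to_identity_linear by (simp add: form_scale)
  qed
  then show ?thesis
    using cotangent_scale[OF p sharp(1)[OF x p], of r]
    by (simp add: inverse_metric_def rp power2_eq_square)
qed

text \<open>Both currents are built from the vector \<open>p\<^sup>\<sharp> + r v\<close>, with momentum \<open>p\<close>, velocity \<open>v\<close> and
  \<open>r = \<plusminus>k/2\<close>. Pairing it with a vector gives the value of the current of that vector, and its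
  square length is the quadratic expression that appears in the energy.\<close>

lemma form_square:
  fixes r :: real
  assumes x: "x \<in> carrier G" and p: "p \<in> cotangent_space G x" and v: "v \<in> tangent_space G x"
  defines "u \<equiv> to_identity x (sharp G g x p) + r *\<^sub>R to_identity x v"
  shows "u \<in> lie_algebra G"
    and "w \<in> tangent_space G x \<Longrightarrow> g u (to_identity x w) = p w + r * metric G g x v w"
    and "g u u = inverse_metric G g x p p + 2 * r * p v + r\<^sup>2 * metric G g x v v"
proof -
  let ?s = "to_identity x (sharp G g x p)" and ?v = "to_identity x v"
  have mem: "?s \<in> lie_algebra G" "?v \<in> lie_algebra G"
    using to_identity_lie_algebra[OF x] sharp(1)[OF x p] v by auto
  then show u: "u \<in> lie_algebra G" by (auto simp: u_def)
  show eq: "g u (to_identity x w) = p w + r * metric G g x v w" if "w \<in> tangent_space G x" for w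
    using mem to_identity_lie_algebra[OF x that] sharp(2)[OF x p that]
    by (simp add: u_def form_add form_scale metric_eq)
  have "g u u = g u ?s + r * g u ?v"
    using u mem unfolding u_def by (simp add: form_add_right form_scale_right)
  also have "\<dots> = inverse_metric G g x p p + 2 * r * p v + r\<^sup>2 * metric G g x v v"
    using eq[OF sharp(1)[OF x p]] eq[OF v] sharp(2)[OF x p v] form_sym[OF mem]
    by (simp add: metric_eq inverse_metric_def power2_eq_square algebra_simps)
  finally show "g u u = inverse_metric G g x p p + 2 * r * p v + r\<^sup>2 * metric G g x v v" .
qed

text \<open>The left-invariant fields of dual bases are dual bases of every tangent space for the
  metric, so the sum is the square length computed in the preceding lemma.\<close>

lemma left_contraction:
  assumes x: "x \<in> carrier G" and p: "p \<in> cotangent_space G x" and v: "v \<in> tangent_space G x"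
  shows "(\<Sum>a<d. (p (left_field G (e a) x) + r * metric G g x (left_field G (e a) x) v) *
                  (p (left_field G (e' a) x) + r * metric G g x (left_field G (e' a) x) v)) =
    inverse_metric G g x p p + 2 * r * p v + r\<^sup>2 * metric G g x v v"
proof -
  define u where "u = to_identity x (sharp G g x p) + r *\<^sub>R to_identity x v"
  note sq = form_square[OF x p v, where r = r, folded u_def]
  have "p (left_field G y x) + r * metric G g x (left_field G y x) v = g u y"
    if "y \<in> lie_algebra G" for y
    using sq(2)[OF left_field_tangent[OF x that]] to_identity_left_field[OF x that] that
      form_sym[OF that to_identity_lie_algebra[OF x v]]
    by (simp add: metric_eq)
  then show ?thesis
    using form_contraction[OF sq(1)] sq(3) by (simp add: basis_lie_algebra)
qed

text \<open>The same for right-invariant fields: invariance moves the adjoint action from the basis vectors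
  to the vector that is contracted, which keeps its length. The signs in the basis vectors cancel in
  the products.\<close>

lemma right_contraction:
  assumes x: "x \<in> carrier G" and p: "p \<in> cotangent_space G x" and v: "v \<in> tangent_space G x"
  shows "(\<Sum>a<d. (p (right_field G (- e a) x) + r * metric G g x (right_field G (- e a) x) v) *
                  (p (right_field G (- e' a) x) + r * metric G g x (right_field G (- e' a) x) v)) =
    inverse_metric G g x p p + 2 * r * p v + r\<^sup>2 * metric G g x v v"
proof -
  define u where "u = to_identity x (sharp G g x p) + r *\<^sub>R to_identity x v"
  note sq = form_square[OF x p v, where r = r, folded u_def]
  have Ad: "adjoint G x u \<in> lie_algebra G" using adjoint_lie_algebra[OF x sq(1)] .
  have "p (right_field G (- y) x) + r * metric G g x (right_field G (- y) x) v = - g (adjoint G x u) y"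
    if y: "y \<in> lie_algebra G" for y
  proof -
    have my: "- y \<in> lie_algebra G" using y by blast
    have "p (right_field G (- y) x) + r * metric G g x (right_field G (- y) x) v =
        g u (adjoint G (inv x) (- y))"
      using sq(2)[OF right_field_tangent[OF x my]] to_identity_right_field[OF x my]
        form_sym[OF to_identity_lie_algebra[OF x right_field_tangent[OF x my]]
          to_identity_lie_algebra[OF x v]]
      by (simp add: metric_eq)
    also have "\<dots> = g (adjoint G x u) (- y)"
      using form_adjoint[OF x sq(1) adjoint_lie_algebra[OF inv_closed[OF x] my]]
        adjoint_adjoint_inv[OF x my] by simp
    also have "\<dots> = - g (adjoint G x u) y"
      using form_scale_right[OF Ad y, of "-1"] by simp
    finally show ?thesis .
  qed
  then show ?thesis
    using form_contraction[OF Ad] form_adjoint[OF x sq(1) sq(1)] sq(3)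
    by (simp add: basis_lie_algebra)
qed

lemma sum_apply: "(\<Sum>a\<in>A. F a) j = (\<Sum>a\<in>A. F a j)"
  by (induction A rule: infinite_finite_induct) auto

lemma jet_base_tangent:
  assumes "(z, \<tau>, u) \<in> jets G S U"
  shows "fst (u (sig S z)) \<in> carrier G"
    "snd (u (sig S z)) \<in> cotangent_space G (fst (u (sig S z)))"
    "velocity G (fst \<circ> u) (sig S z) \<in> tangent_space G (fst (u (sig S z)))"
proof -
  obtain c I where c: "c \<in> atlas G" and I: "open I" "sig S z \<in> I"
    and mem: "\<And>t. t \<in> I \<Longrightarrow> fst (u t) \<in> fst c" "\<And>t. t \<in> I \<Longrightarrow> snd (u t) \<in> cotangent_space G (fst (u t))"
    and sm: "smooth_on I (\<lambda>t. snd c (fst (u t)))"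
    using assms by (auto simp: jets_def smooth_section_at_def)
  show "fst (u (sig S z)) \<in> carrier G" "snd (u (sig S z)) \<in> cotangent_space G (fst (u (sig S z)))"
    using mem I chart_carrier[OF c] by auto
  have "((\<lambda>t. snd c ((fst \<circ> u) t)) has_vector_derivative
      vector_derivative (\<lambda>t. snd c (fst (u t))) (at (sig S z))) (at (sig S z))"
    using smooth_on_imp_differentiable[OF sm I(2)] vector_derivative_works by auto
  then have "velocity G (fst \<circ> u) (sig S z) = coord_vec G c ((fst \<circ> u) (sig S z))
      (vector_derivative (\<lambda>t. snd c (fst (u t))) (at (sig S z)))"
    using mem I by (intro velocity_eq_coord_vec[OF c I]) auto
  then show "velocity G (fst \<circ> u) (sig S z) \<in> tangent_space G (fst (u (sig S z)))"
    using tangent_space_eq_range[OF c mem(1)[OF I(2)]] by auto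
qed

text \<open>Here the parameter \<open>r\<close> of the contractions is \<open>k/2\<close> for the left and \<open>-k/2\<close> for the right
  currents, which explains the sign of the middle term.\<close>

lemma sugawara_at_jet:
  fixes u :: "real \<Rightarrow> 'g \<times> 'g covec"
  assumes j: "(z, \<tau>, u) \<in> jets G S (carrier G)" and "k \<noteq> 0"
  defines "x \<equiv> fst (u (sig S z))" and "p \<equiv> snd (u (sig S z))"
    and "v \<equiv> velocity G (fst \<circ> u) (sig S z)"
  shows "sugawara_l G S g k d e e' (z, \<tau>, u) =
      inverse_metric G g x p p / k + p v + k / 4 * metric G g x v v"
    and "sugawara_r G S g k d e e' (z, \<tau>, u) =
      inverse_metric G g x p p / k - p v + k / 4 * metric G g x v v"
proof -
  note m = jet_base_tangent[OF j, folded x_def p_def v_def]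
  have "sugawara_l G S g k d e e' (z, \<tau>, u) =
      1 / k * (inverse_metric G g x p p + 2 * (k / 2) * p v + (k / 2)\<^sup>2 * metric G g x v v)"
    unfolding left_contraction[OF m, of "k / 2", symmetric] using j
    by (simp add: sugawara_l_def current_l_def vector_function_def form_function_def res_def
        scaleR_fun_def sum_apply x_def p_def v_def)
  then show "sugawara_l G S g k d e e' (z, \<tau>, u) =
      inverse_metric G g x p p / k + p v + k / 4 * metric G g x v v"
    using \<open>k \<noteq> 0\<close> by (simp add: field_simps power2_eq_square)
  have "sugawara_r G S g k d e e' (z, \<tau>, u) =
      1 / k * (inverse_metric G g x p p + 2 * (- k / 2) * p v + (- k / 2)\<^sup>2 * metric G g x v v)"
    unfolding right_contraction[OF m, of "- k / 2", symmetric] using j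
    by (simp add: sugawara_r_def current_r_def vector_function_def form_function_def res_def
        scaleR_fun_def sum_apply x_def p_def v_def)
  then show "sugawara_r G S g k d e e' (z, \<tau>, u) =
      inverse_metric G g x p p / k - p v + k / 4 * metric G g x v v"
    using \<open>k \<noteq> 0\<close> by (simp add: field_simps power2_eq_square)
qed

lemma energy_at_jet:
  fixes u :: "real \<Rightarrow> 'g \<times> 'g covec"
  assumes j: "(z, \<tau>, u) \<in> jets G S (carrier G)"
  defines "x \<equiv> fst (u (sig S z))" and "p \<equiv> snd (u (sig S z))"
    and "v \<equiv> velocity G (fst \<circ> u) (sig S z)"
  shows "energy G S g \<kappa> \<epsilon> (z, \<tau>, u) =
    1/4 * (inverse_metric G g x p p / \<kappa> + \<epsilon> * 2 * p v + \<kappa> * metric G g x v v)"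
  using j by (simp add: energy_def res_def Let_def x_def p_def v_def inverse_eq_divide)

lemma energy_eq_half_sugawara:
  assumes "k \<noteq> 0"
  shows "energy G S g (k / 2) 1 = (1/2) *\<^sub>R sugawara_l G S g k d e e'"
    and "energy G S g (k / 2) (-1) = (1/2) *\<^sub>R sugawara_r G S g k d e e'"
proof -
  have off: "energy G S g (k / 2) \<epsilon> j = 0" "sugawara_l G S g k d e e' j = 0"
    "sugawara_r G S g k d e e' j = 0" if "j \<notin> jets G S (carrier G)" for j \<epsilon>
    using that by (simp_all add: energy_def sugawara_l_def sugawara_r_def current_l_def
        current_r_def vector_function_def form_function_def res_def scaleR_fun_def sum_apply)
  have on: "energy G S g (k / 2) 1 j = 1/2 * sugawara_l G S g k d e e' j"
    "energy G S g (k / 2) (-1) j = 1/2 * sugawara_r G S g k d e e' j"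
    if "j \<in> jets G S (carrier G)" for j
    using that assms by (cases j; simp add: energy_at_jet sugawara_at_jet field_simps)+
  have "energy G S g (k / 2) 1 j = 1/2 * sugawara_l G S g k d e e' j"
    "energy G S g (k / 2) (-1) j = 1/2 * sugawara_r G S g k d e e' j" for j
    using off[of j] on[of j] by (cases "j \<in> jets G S (carrier G)"; simp)+
  then show "energy G S g (k / 2) 1 = (1/2) *\<^sub>R sugawara_l G S g k d e e'"
    "energy G S g (k / 2) (-1) = (1/2) *\<^sub>R sugawara_r G S g k d e e'"
    by (simp_all add: fun_eq_iff scaleR_fun_def)
qed

end

section \<open>Polynomials and difference quotients in charts\<close>

lemma higher_deriv_poly: "(deriv ^^ i) (poly p) = poly ((pderiv ^^ i) p)"
  for p :: "real poly"
  by (induction i) (auto intro!: DERIV_imp_deriv poly_DERIV)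

text \<open>Each differentiation lowers the order of vanishing by at most one.\<close>

lemma linear_power_dvd_higher_pderiv:
  fixes p :: "real poly"
  shows "[:- a, 1:] ^ (m + i) dvd p \<Longrightarrow> [:- a, 1:] ^ m dvd (pderiv ^^ i) p"
proof (induction i arbitrary: m)
  case (Suc i)
  obtain q where q: "(pderiv ^^ i) p = [:- a, 1:] ^ Suc m * q"
    using Suc.IH[of "Suc m"] Suc.prems by (auto elim: dvdE)
  have "pderiv ([:- a, 1:] ^ Suc m * q) = [:- a, 1:] ^ m *
      ([:- a, 1:] * pderiv q + smult (of_nat (Suc m)) (pderiv [:- a, 1:] * q))"
    unfolding pderiv_mult pderiv_power_Suc by (simp only: power_Suc algebra_simps mult_smult_left mult_smult_right)
  then show ?case using q by simp
qed auto

lemma higher_deriv_poly_eq_at_root: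
  fixes p p' :: "real poly"
  assumes "[:- a, 1:] ^ Suc N dvd p - p'" "i \<le> N"
  shows "(deriv ^^ i) (poly p) a = (deriv ^^ i) (poly p') a"
proof -
  have "(pderiv ^^ i) (p - p') = (pderiv ^^ i) p - (pderiv ^^ i) p'"
    by (induction i) (auto simp: pderiv_diff)
  moreover have "[:- a, 1:] ^ (Suc (N - i)) dvd (pderiv ^^ i) (p - p')"
    using assms by (intro linear_power_dvd_higher_pderiv) simp
  then have "[:- a, 1:] dvd (pderiv ^^ i) (p - p')"
    by (rule dvd_trans[rotated]) (rule dvd_power, simp)
  ultimately show ?thesis by (simp add: higher_deriv_poly poly_eq_0_iff_dvd[symmetric])
qed

lemma smooth_on_poly: "open S \<Longrightarrow> smooth_on S (poly p)" for p :: "real poly"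
proof (induction p)
  case (pCons a p)
  then have "smooth_on S (\<lambda>x. a + x * poly p x)"
    by (intro smooth_on_add smooth_on_mult smooth_on_const
        smooth_on_subset[OF smooth_on_bounded_linear[OF bounded_linear_ident]]) auto
  then show ?case by (simp add: fun_eq_iff poly_pCons[abs_def])
qed (simp add: smooth_on_const poly_0[abs_def])

lemma atin_chart_nontrivial:
  fixes \<sigma> :: "'s \<Rightarrow> real"
  assumes W: "is_chart X (W, \<sigma>)" and z: "z \<in> W"
  shows "atin X z \<noteq> bot"
proof
  assume "atin X z = bot"
  then have "eventually (\<lambda>_. False) (atin X z)" by simp
  then obtain T where T: "openin X T" "z \<in> T" "\<And>x. x \<in> T \<Longrightarrow> x = z"
    using chart_subset[OF W] z unfolding eventually_atin by auto
  have "T = {z}" using T(2,3) by blast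
  then have "open {\<sigma> z}"
    using chart_open_image[OF W T(1)] z by simp
  then show False by (simp add: not_open_singleton)
qed

text \<open>The limit that defines the total derivative is taken over the abstract curve; a chart
  given by the coordinate turns it into the derivative with respect to the coordinate. The limit is
  unique because points are not isolated in such a chart.\<close>

lemma Lim_difference_quotient_chart:
  fixes \<sigma> :: "'s \<Rightarrow> real"
  assumes W: "is_chart X (W, \<sigma>)" and T: "openin X T" "z \<in> T" "T \<subseteq> W"
    and F: "\<And>w. w \<in> T \<Longrightarrow> F w = q (\<sigma> w)" and q: "(q has_real_derivative D) (at (\<sigma> z))"
  shows "Lim (atin X z) (\<lambda>w. (F w - F z) / (\<sigma> w - \<sigma> z)) = D"
proof (rule tendsto_Lim)
  show "atin X z \<noteq> bot" using atin_chart_nontrivial[OF W] T by auto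
  have "filterlim \<sigma> (at (\<sigma> z)) (atin X z)"
    unfolding filterlim_at
  proof
    have "inj_on \<sigma> W" using chart_inj_on[OF W] by simp
    then show "\<forall>\<^sub>F w in atin X z. \<sigma> w \<in> UNIV \<and> \<sigma> w \<noteq> \<sigma> z"
      using T unfolding eventually_atin by (auto dest: inj_onD intro!: exI[of _ T])
    show "filterlim \<sigma> (nhds (\<sigma> z)) (atin X z)"
      unfolding tendsto_def
    proof (intro allI impI)
      fix U assume "open U" "\<sigma> z \<in> U"
      then show "\<forall>\<^sub>F w in atin X z. \<sigma> w \<in> U"
        using chart_open_preimage[OF W, of U] T
        unfolding eventually_atin by (auto intro!: exI[of _ "{w \<in> W. \<sigma> w \<in> U}"])
    qed
  qed
  then have "((\<lambda>w. (q (\<sigma> w) - q (\<sigma> z)) / (\<sigma> w - \<sigma> z)) \<longlongrightarrow> D) (atin X z)"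
    using q unfolding has_field_derivative_iff
    by (rule filterlim_compose[rotated])
  then show "((\<lambda>w. (F w - F z) / (\<sigma> w - \<sigma> z)) \<longlongrightarrow> D) (atin X z)"
    by (rule Lim_transform_eventually)
       (use F T in \<open>auto simp: eventually_atin intro!: exI[of _ T]\<close>)
qed

section \<open>Spans of smooth multiples of a function\<close>

text \<open>The generators are already closed under linear combinations, since smooth functions are.\<close>

lemma span_smooth_multiples:
  fixes L :: "('s, 'g) jet \<Rightarrow> real" and S :: "'s worldsheet"
  shows "span {(\<lambda>(z, \<tau>, u). f (sig S z + \<epsilon> * \<tau>)) * L | f. smooth_on (UNIV :: real set) f} =
    {(\<lambda>(z, \<tau>, u). f (sig S z + \<epsilon> * \<tau>)) * L | f. smooth_on (UNIV :: real set) f}" (is "span ?M = ?M")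
proof (rule span_eq_iff[THEN iffD2], rule subspaceI)
  show "0 \<in> ?M"
    by (rule CollectI, rule exI[of _ "\<lambda>_. 0"]) (auto simp: fun_eq_iff smooth_on_const)
  show "F + F' \<in> ?M" if F: "F \<in> ?M" "F' \<in> ?M" for F F'
  proof -
    obtain f f' where "smooth_on UNIV f" "smooth_on UNIV f'"
      "F = (\<lambda>(z, \<tau>, u). f (sig S z + \<epsilon> * \<tau>)) * L" "F' = (\<lambda>(z, \<tau>, u). f' (sig S z + \<epsilon> * \<tau>)) * L"
      using F by blast
    then show ?thesis
      by (intro CollectI exI[of _ "\<lambda>t. f t + f' t"])
         (auto simp: fun_eq_iff algebra_simps intro: smooth_on_add)
  qed
  show "r *\<^sub>R F \<in> ?M" if F: "F \<in> ?M" for r F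
  proof -
    obtain f where "smooth_on UNIV f" "F = (\<lambda>(z, \<tau>, u). f (sig S z + \<epsilon> * \<tau>)) * L"
      using F by blast
    then show ?thesis
      by (intro CollectI exI[of _ "\<lambda>t. r * f t"])
         (auto simp: fun_eq_iff scaleR_fun_def intro: smooth_on_mult smooth_on_const)
  qed
qed

lemma vir_eq:
  "vir G S \<epsilon> L = {lie_class G S ((\<lambda>(z, \<tau>, u). f (sig S z + \<epsilon> * \<tau>)) * L) | f.
     smooth_on (UNIV :: real set) f}"
  unfolding vir_def span_smooth_multiples by blast

lemma vir_scale:
  assumes "c \<noteq> 0" shows "vir G S \<epsilon> (c *\<^sub>R L) = vir G S \<epsilon> L"
proof -
  have le: "vir G S \<epsilon> (c *\<^sub>R L) \<subseteq> vir G S \<epsilon> L" for c L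
  proof
    fix X assume "X \<in> vir G S \<epsilon> (c *\<^sub>R L)"
    then obtain f where f: "smooth_on (UNIV :: real set) f"
      and X: "X = lie_class G S ((\<lambda>(z, \<tau>, u). f (sig S z + \<epsilon> * \<tau>)) * c *\<^sub>R L)"
      unfolding vir_eq by blast
    have "(\<lambda>(z, \<tau>, u). f (sig S z + \<epsilon> * \<tau>)) * c *\<^sub>R L =
        (\<lambda>(z, \<tau>, u). (\<lambda>t. f t * c) (sig S z + \<epsilon> * \<tau>)) * L"
      by (auto simp: fun_eq_iff scaleR_fun_def)
    moreover have "smooth_on UNIV (\<lambda>t. f t * c)"
      using f by (intro smooth_on_mult smooth_on_const) auto
    ultimately show "X \<in> vir G S \<epsilon> L"
      unfolding X vir_eq by (intro CollectI exI[of _ "\<lambda>t. f t * c"]) simp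
  qed
  have "vir G S \<epsilon> (inverse c *\<^sub>R c *\<^sub>R L) \<subseteq> vir G S \<epsilon> (c *\<^sub>R L)" by (rule le)
  then show ?thesis using le[of c L] assms by simp
qed

section \<open>Total derivatives along sections of the cotangent bundle\<close>

text \<open>Invariance under changes of the momenta that keep their derivatives of order up to \<open>N\<close> at the
  point of the jet, the curve in the group being fixed. A single order \<open>N\<close> per polynomial makes it possible to compare sections whose
  momenta differ by a polynomial with a zero of order \<open>N + 1\<close>.\<close>

definition momentum_order_le ::
    "('g, 'e::euclidean_space) lie_group \<Rightarrow> 's worldsheet \<Rightarrow> ('g, 'e) chart \<Rightarrow> nat \<Rightarrow>
      (('s, 'g) jet \<Rightarrow> real) \<Rightarrow> bool" where
  "momentum_order_le G S c N P \<longleftrightarrow> (\<forall>z \<tau> u v. fst \<circ> u = fst \<circ> v \<longrightarrow>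
    (\<forall>i\<le>N. \<forall>b\<in>Basis. (deriv ^^ i) (\<lambda>s. snd (u s) (coord_vec G c (fst (u s)) b)) (sig S z) =
                       (deriv ^^ i) (\<lambda>s. snd (v s) (coord_vec G c (fst (v s)) b)) (sig S z)) \<longrightarrow>
    P (z, \<tau>, u) = P (z, \<tau>, v))"

lemma momentum_order_leD:
  assumes "momentum_order_le G S c N P" "fst \<circ> u = fst \<circ> v"
    and "\<And>i b. i \<le> N \<Longrightarrow> b \<in> Basis \<Longrightarrow>
       (deriv ^^ i) (\<lambda>s. snd (u s) (coord_vec G c (fst (u s)) b)) (sig S z) =
       (deriv ^^ i) (\<lambda>s. snd (v s) (coord_vec G c (fst (v s)) b)) (sig S z)"
  shows "P (z, \<tau>, u) = P (z, \<tau>, v)"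
  by (rule assms(1)[unfolded momentum_order_le_def, rule_format]) (rule assms(2), rule assms(3))

lemma momentum_order_le_mono:
  "momentum_order_le G S c M P \<Longrightarrow> M \<le> N \<Longrightarrow> momentum_order_le G S c N P"
  unfolding momentum_order_le_def by (meson order_trans)

lemma jet_poly_finite_order:
  fixes G :: "('g, 'e::euclidean_space) lie_group"
  assumes "P \<in> jet_poly G S V c"
  shows "\<exists>N. momentum_order_le G S c N P"
  using assms
proof induction
  case (coeff C)
  have "momentum_order_le G S c 0 (\<lambda>(z, \<tau>, u). C (fst (u (sig S z)), z, \<tau>))"
    unfolding momentum_order_le_def
  proof (intro allI impI)
    fix z \<tau> and u v :: "real \<Rightarrow> 'g \<times> 'g covec" assume "fst \<circ> u = fst \<circ> v"
    from fun_cong[OF this, of "sig S z"]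
    show "(case (z, \<tau>, u) of (z, \<tau>, u) \<Rightarrow> C (fst (u (sig S z)), z, \<tau>)) =
      (case (z, \<tau>, v) of (z, \<tau>, u) \<Rightarrow> C (fst (u (sig S z)), z, \<tau>))" by simp
  qed
  then show ?case by blast
next
  case (base_jet i b)
  have "momentum_order_le G S c 0
      (\<lambda>(z, \<tau>, u). (deriv ^^ i) (\<lambda>s. snd c (fst (u s)) \<bullet> b) (sig S z))"
    unfolding momentum_order_le_def
  proof (intro allI impI)
    fix z \<tau> and u v :: "real \<Rightarrow> 'g \<times> 'g covec" assume eq: "fst \<circ> u = fst \<circ> v"
    have "fst (u s) = fst (v s)" for s using fun_cong[OF eq, of s] by simp
    then show "(case (z, \<tau>, u) of (z, \<tau>, u) \<Rightarrow> (deriv ^^ i) (\<lambda>s. snd c (fst (u s)) \<bullet> b) (sig S z)) =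
      (case (z, \<tau>, v) of (z, \<tau>, u) \<Rightarrow> (deriv ^^ i) (\<lambda>s. snd c (fst (u s)) \<bullet> b) (sig S z))" by simp
  qed
  then show ?case by blast
next
  case (fibre_jet b i)
  then have "momentum_order_le G S c i
      (\<lambda>(z, \<tau>, u). (deriv ^^ i) (\<lambda>s. snd (u s) (coord_vec G c (fst (u s)) b)) (sig S z))"
    unfolding momentum_order_le_def by (simp only: prod.case) blast
  then show ?case by blast
next
  case (add P Q)
  then obtain M N where "momentum_order_le G S c M P" "momentum_order_le G S c N Q" by blast
  then have "momentum_order_le G S c (max M N) P" "momentum_order_le G S c (max M N) Q"
    by (auto elim: momentum_order_le_mono)
  then have "momentum_order_le G S c (max M N) (P + Q)"
    unfolding momentum_order_le_def[of _ _ _ _ "P + Q"] plus_fun_apply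
    by (intro allI impI arg_cong2[where f = "(+)"]; elim momentum_order_leD) auto
  then show ?case by blast
next
  case (mult P Q)
  then obtain M N where "momentum_order_le G S c M P" "momentum_order_le G S c N Q" by blast
  then have "momentum_order_le G S c (max M N) P" "momentum_order_le G S c (max M N) Q"
    by (auto elim: momentum_order_le_mono)
  then have "momentum_order_le G S c (max M N) (P * Q)"
    unfolding momentum_order_le_def[of _ _ _ _ "P * Q"] times_fun_apply
    by (intro allI impI arg_cong2[where f = "(*)"]; elim momentum_order_leD) auto
  then show ?case by blast
qed

context smooth_group
begin

text \<open>Along a smooth section, the jet coordinates become derivatives of smooth functions and the
  coefficients become smooth functions of the coordinate.\<close>

lemma jet_poly_differentiable_along:
  assumes P: "P \<in> jet_poly G S V c" and c: "c \<in> atlas G" "V \<subseteq> fst c"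
    and W: "is_chart (stop S) (W, sig S)" and J: "open J" "J \<subseteq> sig S ` W" and \<tau>: "\<tau> \<in> taus S"
    and u: "\<And>t. t \<in> J \<Longrightarrow> fst (u t) \<in> V" "smooth_on J (\<lambda>t. snd c (fst (u t)))"
      "\<And>a. smooth_on J (\<lambda>t. snd (u t) (coord_vec G c (fst (u t)) a))"
    and s: "s \<in> J"
  shows "(\<lambda>s. P (chart_inv (W, sig S) s, \<tau>, u)) differentiable (at s)"
proof -
  have sig: "sig S (chart_inv (W, sig S) t) = t" if "t \<in> J" for t
    using J that by (auto simp: f_inv_into_f)
  have onJ: "f differentiable (at s)" if "g differentiable (at s)" "\<And>t. t \<in> J \<Longrightarrow> g t = f t"
    for f g :: "real \<Rightarrow> real"
  proof -
    have "(g has_derivative frechet_derivative g (at s)) (at s)"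
      using that(1) by (simp add: frechet_derivative_works)
    then have "(f has_derivative frechet_derivative g (at s)) (at s)"
      by (rule has_derivative_transform_within_open[OF _ J(1) s]) (rule that(2))
    then show ?thesis by (rule differentiableI)
  qed
  have jet: "(\<lambda>t. (deriv ^^ i) f (sig S (chart_inv (W, sig S) t))) differentiable (at s)"
    if "smooth_on J f" for i f
    by (rule onJ[OF smooth_on_imp_differentiable[OF smooth_on_higher_deriv[OF J(1) that, of i] s]])
       (use sig in simp)
  show ?thesis
    using P
  proof induction
    case (coeff C)
    let ?C = "\<lambda>(a, t, \<tau>). C (chart_inv c a, chart_inv (W, sig S) t, \<tau>)"
    have "smooth_on ((snd c ` (fst c \<inter> V)) \<times> (sig S ` W) \<times> taus S) ?C"
      using coeff c(1) W by (simp add: smooth_coeff_def)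
    then have "?C differentiable (at (snd c (fst (u s)), s, \<tau>))"
      by (rule smooth_on_imp_differentiable) (use c u(1) s J \<tau> in auto)
    moreover have "(\<lambda>t. (snd c (fst (u t)), t, \<tau>)) differentiable (at s)"
      using smooth_on_imp_differentiable[OF u(2) s]
      by (intro differentiable_Pair differentiable_ident differentiable_const)
    ultimately have "(?C \<circ> (\<lambda>t. (snd c (fst (u t)), t, \<tau>))) differentiable (at s)"
      by (intro differentiable_chain_at) auto
    then show ?case
      by (rule onJ) (use c u(1) sig in \<open>auto simp: chart_left subset_iff\<close>)
  next
    case (base_jet i b)
    then show ?case
      using jet[OF smooth_on_linear[OF bounded_linear_inner_left J(1) u(2)]] by simp
  next
    case (fibre_jet b i)
    then show ?case using jet[OF u(3)] by simp
  qed (simp_all add: plus_fun_apply times_fun_apply differentiable_add differentiable_mult)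
qed

text \<open>The characteristic property of the total derivative: restricted to a section, it is the
  ordinary derivative of the restricted function.\<close>

lemma total_deriv_along_section:
  fixes u :: "real \<Rightarrow> 'g \<times> 'g covec"
  assumes P: "P \<in> jet_poly G S V' c" "\<And>j. j \<in> jets G S V' \<Longrightarrow> Q j = P j"
    and c: "c \<in> atlas G" "V' \<subseteq> fst c" "V' \<subseteq> V"
    and W: "is_chart (stop S) (W, sig S)" and J: "open J" "J \<subseteq> sig S ` W" and \<tau>: "\<tau> \<in> taus S"
    and u: "\<And>t. t \<in> J \<Longrightarrow> fst (u t) \<in> V'" "\<And>t. t \<in> J \<Longrightarrow> snd (u t) \<in> cotangent_space G (fst (u t))"
      "smooth_on J (\<lambda>t. snd c (fst (u t)))"
      "\<And>a. smooth_on J (\<lambda>t. snd (u t) (coord_vec G c (fst (u t)) a))"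
    and s: "s \<in> J"
  shows "(chart_inv (W, sig S) s, \<tau>, u) \<in> jets G S V"
    and "((\<lambda>s. P (chart_inv (W, sig S) s, \<tau>, u)) has_real_derivative
           total_deriv G S V Q (chart_inv (W, sig S) s, \<tau>, u)) (at s)"
proof -
  let ?ci = "chart_inv (W, sig S)"
  let ?q = "\<lambda>s. P (?ci s, \<tau>, u)"
  have jetI: "(w, \<tau>, u) \<in> jets G S V'" if "w \<in> W" "sig S w \<in> J" for w
  proof -
    have "smooth_section_at G u (sig S w)"
      unfolding smooth_section_at_def
      by (intro bexI[OF _ c(1)] exI[of _ J] conjI J(1) that(2) ballI allI u(2-4)) (use u(1) c in blast)
    then show ?thesis using that chart_subset[OF W] \<tau> u(1) by (auto simp: jets_def)
  qed
  have ci: "?ci t \<in> W" "sig S (?ci t) = t" if "t \<in> J" for t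
    using J that by (auto simp: f_inv_into_f inv_into_into)
  have "jets G S V' \<subseteq> jets G S V" using c(3) by (auto simp: jets_def)
  then show mem: "(?ci s, \<tau>, u) \<in> jets G S V" using jetI ci[OF s] s by auto
  obtain D where D: "(?q has_real_derivative D) (at s)"
    using jet_poly_differentiable_along[OF P(1) c(1,2) W J \<tau> u(1,3,4) s]
    by (auto simp: real_differentiable_def)
  have "Lim (atin (stop S) (?ci s))
      (\<lambda>w. (Q (w, \<tau>, u) - Q (?ci s, \<tau>, u)) / (sig S w - sig S (?ci s))) = D"
  proof (rule Lim_difference_quotient_chart[OF W])
    show "openin (stop S) {w \<in> W. sig S w \<in> J}"
      using chart_open_preimage[OF W J(1)] by simp
    show "?ci s \<in> {w \<in> W. sig S w \<in> J}" using ci[OF s] s by simp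
    show "Q (w, \<tau>, u) = ?q (sig S w)" if "w \<in> {w \<in> W. sig S w \<in> J}" for w
      using that P(2)[OF jetI] chart_inv_left[OF W, of w] by simp
  qed (use D ci[OF s] in auto)
  then show "(?q has_real_derivative total_deriv G S V Q (?ci s, \<tau>, u)) (at s)"
    using D mem by (simp add: total_deriv_def res_def)
qed

definition coordinate_differential :: "('g, 'e) chart \<Rightarrow> 'e \<Rightarrow> 'g \<Rightarrow> 'g covec" where
  "coordinate_differential c a x =
     (\<lambda>v. if v \<in> tangent_space G x then v (\<lambda>y. snd c y \<bullet> a) else 0)"

lemma cotangent_scaleR:
  "p \<in> cotangent_space G x \<Longrightarrow> r *\<^sub>R p \<in> cotangent_space G x"
  by (auto simp: cotangent_space_def scaleR_fun_def algebra_simps)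

lemma coordinate_differential_cotangent:
  assumes "x \<in> carrier G" shows "coordinate_differential c a x \<in> cotangent_space G x"
proof -
  note sub = subspace_tangent_space[OF assms]
  have "(r *\<^sub>R v) f = r * v f" for r f and v :: "'g tvec"
    by (simp add: scaleR_fun_def)
  then show ?thesis
    unfolding cotangent_space_def coordinate_differential_def
    by (intro CollectI conjI ballI allI impI)
       (simp_all only: subspace_add[OF sub] subspace_scale[OF sub] if_True if_False plus_fun_apply)
qed

lemma coordinate_differential_coord_vec:
  "c \<in> atlas G \<Longrightarrow> x \<in> fst c \<Longrightarrow> coordinate_differential c a x (coord_vec G c x b) = b \<bullet> a"
  using tangent_space_eq_range coord_vec_coordinate by (auto simp: coordinate_differential_def)

text \<open>The curve is a straight line in the chart, passing through \<open>x\<close> at \<open>s0\<close> with velocity \<open>w\<close>, and its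
  momentum is a polynomial multiple of the differential of the linear coordinate dual to \<open>a\<close>.\<close>

definition test_section ::
    "('g, 'e) chart \<Rightarrow> 'g \<Rightarrow> real \<Rightarrow> 'e \<Rightarrow> 'e \<Rightarrow> real poly \<Rightarrow> real \<Rightarrow> 'g \<times> 'g covec" where
  "test_section c x s0 w a p = (\<lambda>s. let y = chart_inv c (snd c x + (s - s0) *\<^sub>R w)
     in (y, poly p s *\<^sub>R coordinate_differential c a y))"

lemma test_section_at:
  fixes a :: 'e and p :: "real poly"
  assumes c: "c \<in> atlas G" and s: "snd c x + (s - s0) *\<^sub>R w \<in> snd c ` V" and V: "V \<subseteq> fst c"
  defines "u \<equiv> test_section c x s0 w a p"
  shows "fst (u s) \<in> V" "snd c (fst (u s)) = snd c x + (s - s0) *\<^sub>R w"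
    "snd (u s) = poly p s *\<^sub>R coordinate_differential c a (fst (u s))"
    "snd (u s) \<in> cotangent_space G (fst (u s))"
    "snd (u s) (coord_vec G c (fst (u s)) b) = poly p s * (b \<bullet> a)"
proof -
  obtain y where y: "y \<in> V" "snd c x + (s - s0) *\<^sub>R w = snd c y" using s by auto
  then have fst: "fst (u s) = y"
    using V c by (auto simp: u_def test_section_def Let_def chart_left)
  show "fst (u s) \<in> V" "snd c (fst (u s)) = snd c x + (s - s0) *\<^sub>R w" using fst y by auto
  show snd: "snd (u s) = poly p s *\<^sub>R coordinate_differential c a (fst (u s))"
    by (simp add: u_def test_section_def Let_def)
  show "snd (u s) \<in> cotangent_space G (fst (u s))"
    unfolding snd using fst y V chart_carrier[OF c]
    by (intro cotangent_scaleR coordinate_differential_cotangent) auto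
  show "snd (u s) (coord_vec G c (fst (u s)) b) = poly p s * (b \<bullet> a)"
    unfolding snd using fst y V coordinate_differential_coord_vec[OF c]
    by (auto simp: scaleR_fun_def)
qed

lemma velocity_test_section:
  assumes c: "c \<in> atlas G" and V: "openin (gtop G) V" "V \<subseteq> fst c"
    and s: "snd c x + (s - s0) *\<^sub>R w \<in> snd c ` V"
  shows "velocity G (fst \<circ> test_section c x s0 w a p) s =
    coord_vec G c (fst (test_section c x s0 w a p s)) w"
proof -
  let ?l = "\<lambda>t. snd c x + (t - s0) *\<^sub>R w"
  let ?J = "?l -` (snd c ` V)"
  have J: "open ?J"
    using open_chart_image[OF c V] by (intro open_vimage) (auto intro!: continuous_intros)
  have "(?l has_vector_derivative w) (at s)"
    by (auto intro!: derivative_eq_intros)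
  then have "((\<lambda>t. snd c ((fst \<circ> test_section c x s0 w a p) t)) has_vector_derivative w) (at s)"
    by (rule has_vector_derivative_transform_within_open[OF _ J])
       (use s test_section_at(2)[OF c _ V(2)] in auto)
  then show ?thesis
    using velocity_eq_coord_vec[OF c J, of s "fst \<circ> test_section c x s0 w a p" w]
      s test_section_at(1)[OF c _ V(2)] V(2) by fastforce
qed

text \<open>Rolle's theorem. If the momenta of two test sections over the same curve agree to high order at
  both ends of an interval, then a local section \<open>Q\<close> takes the same values on them at both ends. The
  difference of the values has the difference of the total derivatives as its derivative, which must
  vanish somewhere in between. The order \<open>N\<close> does not depend on the interval, which may be as short
  as desired.\<close>

lemma total_deriv_agree_between:
  assumes Q: "Q \<in> SD G S V" and x: "x \<in> V"
    and W: "is_chart (stop S) (W, sig S)" and s0: "s0 \<in> sig S ` W" and \<tau>: "\<tau> \<in> taus S"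
  obtains c N where "c \<in> atlas G" "x \<in> fst c"
    "\<And>w. \<exists>\<delta>>0. \<forall>lo hi a p p'. s0 - \<delta> < lo \<longrightarrow> lo < hi \<longrightarrow> hi < s0 + \<delta> \<longrightarrow>
       [:- lo, 1:] ^ Suc N dvd p - p' \<longrightarrow> [:- hi, 1:] ^ Suc N dvd p - p' \<longrightarrow>
       (\<exists>s\<in>{lo<..<hi}. s \<in> sig S ` W \<and>
          (\<exists>V' \<subseteq> fst c. openin (gtop G) V' \<and> snd c x + (s - s0) *\<^sub>R w \<in> snd c ` V') \<and>
          (\<forall>r\<in>{p, p'}. (chart_inv (W, sig S) s, \<tau>, test_section c x s0 w a r) \<in> jets G S V) \<and>
          total_deriv G S V Q (chart_inv (W, sig S) s, \<tau>, test_section c x s0 w a p) =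
          total_deriv G S V Q (chart_inv (W, sig S) s, \<tau>, test_section c x s0 w a p'))"
proof -
  have "\<exists>c\<in>atlas G. \<exists>V'. openin (gtop G) V' \<and> x \<in> V' \<and> V' \<subseteq> V \<inter> fst c \<and>
      (\<exists>P\<in>jet_poly G S V' c. \<forall>j\<in>jets G S V'. Q j = P j)"
    using Q[unfolded SD_def, THEN CollectD, THEN conjunct2] x by (rule bspec)
  then obtain c V' P where c: "c \<in> atlas G"
    and V'0: "openin (gtop G) V'" "x \<in> V'" "V' \<subseteq> V \<inter> fst c"
    and P0: "P \<in> jet_poly G S V' c" "\<forall>j\<in>jets G S V'. Q j = P j"
    by (elim bexE exE conjE)
  note P = P0(1) P0(2)[rule_format]
  have V': "openin (gtop G) V'" "x \<in> V'" "V' \<subseteq> fst c" "V' \<subseteq> V" using V'0 by auto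
  let ?ci = "chart_inv (W, sig S)"
  obtain N where N: "momentum_order_le G S c N P"
    using jet_poly_finite_order[OF P(1)] ..
  have "\<exists>\<delta>>0. \<forall>lo hi a p p'. s0 - \<delta> < lo \<longrightarrow> lo < hi \<longrightarrow> hi < s0 + \<delta> \<longrightarrow>
       [:- lo, 1:] ^ Suc N dvd p - p' \<longrightarrow> [:- hi, 1:] ^ Suc N dvd p - p' \<longrightarrow>
       (\<exists>s\<in>{lo<..<hi}. s \<in> sig S ` W \<and>
          (\<exists>V' \<subseteq> fst c. openin (gtop G) V' \<and> snd c x + (s - s0) *\<^sub>R w \<in> snd c ` V') \<and>
          (\<forall>r\<in>{p, p'}. (?ci s, \<tau>, test_section c x s0 w a r) \<in> jets G S V) \<and>
          total_deriv G S V Q (?ci s, \<tau>, test_section c x s0 w a p) =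
          total_deriv G S V Q (?ci s, \<tau>, test_section c x s0 w a p'))" for w
  proof -
    let ?l = "\<lambda>t. snd c x + (t - s0) *\<^sub>R w"
    define J where "J = ?l -` (snd c ` V') \<inter> sig S ` W"
    have oW: "open (sig S ` W)" using W by (simp add: is_chart_def)
    have J: "open J" "J \<subseteq> sig S ` W"
      unfolding J_def using open_chart_image[OF c V'(1,3)] oW
      by (auto intro!: open_Int open_vimage continuous_intros)
    have "s0 \<in> J" using s0 V'(2) by (simp add: J_def)
    then obtain \<delta> where \<delta>: "\<delta> > 0" "ball s0 \<delta> \<subseteq> J"
      using J(1) open_contains_ball by blast
    have inJ: "?l t \<in> snd c ` V'" if "t \<in> J" for t using that by (simp add: J_def)
    note at = test_section_at[OF c inJ V'(3)]
    have sm1: "smooth_on J (\<lambda>t. snd c (fst (test_section c x s0 w a p t)))" for a p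
    proof (rule smooth_on_cong[OF J(1)])
      have "smooth_on J (\<lambda>t. (snd c x - s0 *\<^sub>R w) + t *\<^sub>R w)"
        using J(1) by (intro smooth_on_add smooth_on_const
            smooth_on_subset[OF smooth_on_bounded_linear[OF bounded_linear_scaleR_left]]) auto
      then show "smooth_on J ?l" by (simp add: algebra_simps)
    qed (simp add: at(2))
    have sm2: "smooth_on J (\<lambda>t. snd (test_section c x s0 w a p t)
        (coord_vec G c (fst (test_section c x s0 w a p t)) b))" for a p b
      by (rule smooth_on_cong[OF J(1) smooth_on_mult[OF J(1) smooth_on_poly[OF J(1)] smooth_on_const]])
         (simp add: at(5))
    have along: "(?ci s, \<tau>, test_section c x s0 w a p) \<in> jets G S V"
        "((\<lambda>s. P (?ci s, \<tau>, test_section c x s0 w a p)) has_real_derivative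
           total_deriv G S V Q (?ci s, \<tau>, test_section c x s0 w a p)) (at s)"
      if "s \<in> J" for s a p
      by (rule total_deriv_along_section[OF P c V'(3,4) W J \<tau> at(1) at(4) sm1 sm2],
          assumption, assumption, assumption, rule that)+
    show ?thesis
    proof (intro exI[of _ \<delta>] conjI allI impI)
      fix lo hi a p p'
      assume lh: "s0 - \<delta> < lo" "lo < hi" "hi < s0 + \<delta>"
        and dvd: "[:- lo, 1:] ^ Suc N dvd p - p'" "[:- hi, 1:] ^ Suc N dvd p - p'"
      let ?u = "test_section c x s0 w a p" and ?u' = "test_section c x s0 w a p'"
      have sub: "t \<in> J" if "t \<in> {lo..hi}" for t
        using that lh \<delta>(2) by (auto simp: dist_real_def subset_iff)
      have same: "P (?ci t, \<tau>, ?u) = P (?ci t, \<tau>, ?u')"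
        if t: "t \<in> J" and dvd: "[:- t, 1:] ^ Suc N dvd p - p'" for t
      proof (rule momentum_order_leD[OF N])
        show "fst \<circ> ?u = fst \<circ> ?u'" by (simp add: fun_eq_iff test_section_def Let_def)
        have sig: "sig S (?ci t) = t" using t J(2) by (auto simp: f_inv_into_f)
        fix i b assume "i \<le> N"
        have eq: "(deriv ^^ i) (\<lambda>s. snd (test_section c x s0 w a r s)
              (coord_vec G c (fst (test_section c x s0 w a r s)) b)) t =
            (deriv ^^ i) (poly (smult (b \<bullet> a) r)) t" for r
          by (rule higher_deriv_cong_open[OF J(1) _ t]) (simp add: at(5))
        have "[:- t, 1:] ^ Suc N dvd smult (b \<bullet> a) p - smult (b \<bullet> a) p'"
          using dvd_smult[OF dvd, of "b \<bullet> a"] by (simp add: smult_diff_right)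
        then show "(deriv ^^ i) (\<lambda>s. snd (?u s) (coord_vec G c (fst (?u s)) b)) (sig S (?ci t)) =
            (deriv ^^ i) (\<lambda>s. snd (?u' s) (coord_vec G c (fst (?u' s)) b)) (sig S (?ci t))"
          unfolding sig eq using \<open>i \<le> N\<close> by (rule higher_deriv_poly_eq_at_root)
      qed
      have der: "((\<lambda>s. P (?ci s, \<tau>, ?u) - P (?ci s, \<tau>, ?u')) has_real_derivative
          total_deriv G S V Q (?ci t, \<tau>, ?u) - total_deriv G S V Q (?ci t, \<tau>, ?u')) (at t)"
        if "t \<in> J" for t
        by (intro DERIV_diff along(2) that)
      \<comment> \<open>The mean value theorem, with difference 0 of the values at the ends.\<close>
      have "\<exists>t>lo. t < hi \<and> P (?ci hi, \<tau>, ?u) - P (?ci hi, \<tau>, ?u')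
            - (P (?ci lo, \<tau>, ?u) - P (?ci lo, \<tau>, ?u')) = (hi - lo) *
          (total_deriv G S V Q (?ci t, \<tau>, ?u) - total_deriv G S V Q (?ci t, \<tau>, ?u'))"
        using lh(2) der sub by (intro MVT2) auto
      then obtain t where t: "lo < t" "t < hi" "0 = (hi - lo) *
          (total_deriv G S V Q (?ci t, \<tau>, ?u) - total_deriv G S V Q (?ci t, \<tau>, ?u'))"
        using same[OF sub dvd(1)] same[OF sub dvd(2)] lh(2) by auto
      then have tJ: "t \<in> J" using sub by simp
      show "\<exists>s\<in>{lo<..<hi}. s \<in> sig S ` W \<and>
          (\<exists>V' \<subseteq> fst c. openin (gtop G) V' \<and> snd c x + (s - s0) *\<^sub>R w \<in> snd c ` V') \<and>
          (\<forall>r\<in>{p, p'}. (?ci s, \<tau>, test_section c x s0 w a r) \<in> jets G S V) \<and>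
          total_deriv G S V Q (?ci s, \<tau>, ?u) = total_deriv G S V Q (?ci s, \<tau>, ?u')"
        using t tJ J(2) along(1)[OF tJ] V' inJ[OF tJ]
        by (intro bexI[of _ t] conjI exI[of _ V']) auto
    qed (use \<delta> in auto)
  qed
  with that c V' show thesis by blast
qed

lemma zero_in_SD: assumes "openin (gtop G) V" shows "0 \<in> SD G S V"
proof -
  have "\<exists>c\<in>atlas G. \<exists>V'. openin (gtop G) V' \<and> x \<in> V' \<and> V' \<subseteq> V \<inter> fst c \<and>
      (\<exists>P\<in>jet_poly G S V' c. \<forall>j\<in>jets G S V'. 0 j = P j)" if x: "x \<in> V" for x
  proof -
    obtain c where c: "c \<in> atlas G" "x \<in> fst c"
      using chart_cover x openin_subset[OF assms] topspace_eq by blast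
    have "(\<lambda>(z, \<tau>, u). (\<lambda>_. 0) (fst (u (sig S z)), z, \<tau>)) \<in> jet_poly G S (V \<inter> fst c) c"
      by (rule jet_poly.coeff) (auto simp: smooth_coeff_def case_prod_unfold smooth_on_const)
    then have "(\<lambda>_. 0) \<in> jet_poly G S (V \<inter> fst c) c" by (simp add: case_prod_unfold)
    with c x openin_Int[OF assms chart_openin[OF c(1)]] show ?thesis
      by (intro bexI[of _ c] exI[of _ "V \<inter> fst c"]) (auto intro!: bexI[of _ "\<lambda>_. 0"])
  qed
  then show ?thesis by (auto simp: SD_def)
qed

text \<open>Classes are cosets of subsets; that each contains its representative amounts to 0
  being a total derivative.\<close>

lemma lie_germ_refl:
  assumes S: "is_worldsheet S" and x: "x \<in> carrier G"
  shows "F \<in> lie_germ G S F x"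
proof -
  have "atin (stop S) z \<noteq> bot" if "z \<in> topspace (stop S)" for z
    using S that atin_chart_nontrivial[of "stop S" _ "sig S" z] unfolding is_worldsheet_def by blast
  then have "res G S (carrier G) (F - F) = total_deriv G S (carrier G) 0"
    by (auto simp: fun_eq_iff total_deriv_def res_def jets_def tendsto_Lim)
  moreover have "0 \<in> SD G S (carrier G)"
    using zero_in_SD openin_topspace topspace_eq by metis
  ultimately show ?thesis
    using x openin_topspace[of "gtop G"] topspace_eq unfolding lie_germ_def
    by (intro CollectI exI[of _ "carrier G"] conjI) auto
qed

end

text \<open>Rolle's theorem yields an equation at some point of every short interval. Continuity of the
  unknown function transfers it to the centre of the intervals.\<close>

lemma ex_close_imp_eq:
  fixes h :: "real \<Rightarrow> real"
  assumes "isCont h s" "\<And>\<delta>. \<delta> > 0 \<Longrightarrow> \<exists>t. \<bar>t - s\<bar> < \<delta> \<and> h t = K"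
  shows "h s = K"
proof (rule ccontr)
  assume "h s \<noteq> K"
  then have "\<forall>\<^sub>F t in nhds s. h t \<noteq> K"
    using assms(1) by (intro tendsto_imp_eventually_ne) (auto simp: isCont_def tendsto_nhds_iff)
  then obtain \<delta> where "\<delta> > 0" "\<And>t. dist t s < \<delta> \<Longrightarrow> h t \<noteq> K"
    by (auto simp: eventually_nhds_metric)
  then show False using assms(2)[of \<delta>] by (auto simp: dist_real_def)
qed

section \<open>The level is determined by the Virasoro subspaces\<close>

lemma ex_poly_vanishing_at_endpoints:
  fixes lo hi :: real
  obtains p :: "real poly" where "[:- lo, 1:] ^ n dvd p" "[:- hi, 1:] ^ n dvd p"
    "\<And>s. s \<in> {lo<..<hi} \<Longrightarrow> poly p s \<noteq> 0"
proof
  show "[:- lo, 1:] ^ n dvd ([:- lo, 1:] * [:- hi, 1:]) ^ n"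
    "[:- hi, 1:] ^ n dvd ([:- lo, 1:] * [:- hi, 1:]) ^ n"
    by (simp_all only: power_mult_distrib dvd_triv_left dvd_triv_right)
next
  fix s assume "s \<in> {lo<..<hi}"
  moreover have "poly (([:- lo, 1:] * [:- hi, 1:]) ^ n) s = ((s - lo) * (s - hi)) ^ n"
    by (simp add: poly_power algebra_simps)
  ultimately show "poly (([:- lo, 1:] * [:- hi, 1:]) ^ n) s \<noteq> 0" by auto
qed

context metric_group
begin

text \<open>Polarization: a symmetric form that vanishes on the diagonal vanishes, contrary to
  nondegeneracy. The form may be indefinite, so the given vector itself may be null.\<close>

lemma ex_form_square_nonzero:
  assumes y: "y \<in> lie_algebra G" "y \<noteq> 0"
  obtains z where "z \<in> lie_algebra G" "g z z \<noteq> 0"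
proof -
  obtain w where w: "w \<in> lie_algebra G" "g y w \<noteq> 0"
    using form_nondegenerate[OF y(1)] y(2) by metis
  have sum: "y + w \<in> lie_algebra G" using y(1) w(1) by blast
  have "g (y + w) (y + w) = g y y + 2 * g y w + g w w"
    by (simp only: form_add[OF y(1) w(1) sum] form_add_right[OF y(1) w(1)] y(1) w(1)
        form_sym[OF w(1) y(1)])
  then show thesis using that[of y] that[of w] that[OF sum] y(1) w by force
qed

text \<open>The metric dual of a vector that is not null is such a covector; every covector at \<open>x\<close> is
  the differential of a linear coordinate.\<close>

lemma ex_coordinate_differential_nonnull:
  assumes c: "c \<in> atlas G" "x \<in> fst c"
  obtains a where
    "inverse_metric G g x (coordinate_differential c a x) (coordinate_differential c a x) \<noteq> 0"
proof -
  have x: "x \<in> carrier G" using chart_carrier[OF c] .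
  have tangent: "coord_vec G c x b \<in> tangent_space G x" for b
    unfolding tangent_space_eq_range[OF c] by (rule rangeI)
  obtain b :: 'e where b: "b \<in> Basis" using nonempty_Basis by blast
  let ?v = "coord_vec G c x b"
  have "to_identity x ?v \<noteq> 0"
  proof
    assume "to_identity x ?v = 0"
    then have "?v = left_field G 0 x"
      using left_field_to_identity[OF x tangent[of b]] by simp
    then have "?v (\<lambda>y. snd c y \<bullet> b) = 0" by (simp add: left_field_def push_def)
    then show False using coord_vec_coordinate[OF c, of b b] b by simp
  qed
  then obtain z where z: "z \<in> lie_algebra G" "g z z \<noteq> 0"
    using ex_form_square_nonzero to_identity_lie_algebra[OF x tangent] by metis
  define v where "v = left_field G z x"
  have v: "v \<in> tangent_space G x" "metric G g x v v \<noteq> 0"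
    using left_field_tangent[OF x z(1)] to_identity_left_field[OF x z(1)] z(2)
    by (simp_all add: v_def metric_eq)
  define f where "f = (\<lambda>b. metric G g x v (coord_vec G c x b))"
  have "linear f"
    using to_identity_lie_algebra[OF x] tangent v(1)
    by (intro linearI)
       (simp_all add: f_def metric_eq coord_vec_add[OF c] coord_vec_scale[OF c] to_identity_linear
         form_add_right form_scale_right)
  define a where "a = (\<Sum>b\<in>Basis. f b *\<^sub>R b)"
  have f: "f w = w \<bullet> a" for w
  proof -
    have "f w = f (\<Sum>b\<in>Basis. (w \<bullet> b) *\<^sub>R b)" by (simp only: euclidean_representation)
    also have "\<dots> = (\<Sum>b\<in>Basis. (w \<bullet> b) * f b)"
      using \<open>linear f\<close> by (simp only: linear_sum linear_scale real_scaleR_def)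
    finally show ?thesis by (simp add: a_def inner_sum_right mult.commute)
  qed
  let ?p = "coordinate_differential c a x"
  have p: "metric G g x v w = ?p w" if "w \<in> tangent_space G x" for w
    using that f coordinate_differential_coord_vec[OF c]
    unfolding tangent_space_eq_range[OF c] f_def by auto
  have "sharp G g x ?p = v" by (rule sharp_eqI[OF x v(1) p])
  then have "inverse_metric G g x ?p ?p = metric G g x v v"
    using p[OF v(1)] by (simp add: inverse_metric_def)
  then show thesis using that v(2) by metis
qed

text \<open>Of the three terms only the middle one is odd in the momentum, and only the first one
  survives at zero velocity; this is how their coefficients are separated.\<close>

lemma defect_at_test_section:
  fixes a :: 'e and p :: "real poly"
  assumes "k \<noteq> 0" "\<kappa> \<noteq> 0" and c: "c \<in> atlas G" and V: "openin (gtop G) V" "V \<subseteq> fst c"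
    and s: "snd c x + (s - s0) *\<^sub>R w \<in> snd c ` V" and z: "sig S z = s"
    and j: "(z, \<tau>, test_section c x s0 w a p) \<in> jets G S (carrier G)"
  defines "y \<equiv> chart_inv c (snd c x + (s - s0) *\<^sub>R w)"
  shows "energy G S g \<kappa> 1 (z, \<tau>, test_section c x s0 w a p) -
      h * sugawara_l G S g k d e e' (z, \<tau>, test_section c x s0 w a p) =
    (1 / (4 * \<kappa>) - h / k) * (poly p s)\<^sup>2 *
      inverse_metric G g y (coordinate_differential c a y) (coordinate_differential c a y) +
    (1 / 2 - h) * (poly p s * (w \<bullet> a)) +
    (\<kappa> - h * k) / 4 * metric G g y (coord_vec G c y w) (coord_vec G c y w)"
proof -
  let ?u = "test_section c x s0 w a p" and ?q = "coordinate_differential c a y"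
  note at = test_section_at[OF c s V(2), where a = a and p = p]
  have fst: "fst (?u s) = y" by (simp add: y_def test_section_def Let_def)
  have y: "y \<in> fst c" "y \<in> carrier G" using at(1) V(2) chart_carrier[OF c] fst by auto
  have snd: "snd (?u s) = poly p s *\<^sub>R ?q" using at(3) fst by simp
  have I: "inverse_metric G g y (snd (?u s)) (snd (?u s)) = (poly p s)\<^sup>2 * inverse_metric G g y ?q ?q"
    unfolding snd by (rule inverse_metric_scale[OF y(2) coordinate_differential_cotangent[OF y(2)]])
  have v: "velocity G (fst \<circ> ?u) s = coord_vec G c y w"
    using velocity_test_section[OF c V s] fst by simp
  have pv: "snd (?u s) (coord_vec G c y w) = poly p s * (w \<bullet> a)" using at(5) fst by simp
  show ?thesis
    unfolding sugawara_at_jet(1)[OF j \<open>k \<noteq> 0\<close>, unfolded z fst v pv I]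
      energy_at_jet[OF j, of \<kappa> 1, unfolded z fst v pv I]
    using assms(1,2) by (simp add: field_simps)
qed

text \<open>Equality of the subspaces gives a function \<open>h\<close> for which \<open>energy - h * sugawara_l\<close> is a total
  derivative near the identity, since the energy itself is one of the generators. Two comparisons of
  test sections show that the coefficients of the momentum terms in this difference vanish, that is
  \<open>h = 1/2\<close> and \<open>h = k/(4\<kappa>)\<close> at one and the same point.\<close>

lemma vir_plus_eq_vir_l_imp_level:
  assumes S: "is_worldsheet S" and k: "k \<noteq> 0" and \<kappa>: "\<kappa> \<noteq> 0"
    and eq: "vir_plus G S g \<kappa> = vir_l G S g k d e e'"
  shows "\<kappa> = k / 2"
proof -
  let ?E = "energy G S g \<kappa> 1" and ?L = "sugawara_l G S g k d e e'"
  have "(\<lambda>(z, \<tau>, u). (\<lambda>_. 1) (sig S z + 1 * \<tau>)) * ?E = ?E" by (auto simp: fun_eq_iff)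
  then have "lie_class G S ?E \<in> vir_plus G S g \<kappa>"
    unfolding vir_plus_def vir_eq using smooth_on_const[of UNIV "1 :: real"]
    by (intro CollectI exI[of _ "\<lambda>_. 1"]) auto
  then obtain h where h: "smooth_on (UNIV :: real set) h"
    and cls: "lie_class G S ?E = lie_class G S ((\<lambda>(z, \<tau>, u). h (sig S z + 1 * \<tau>)) * ?L)"
      (is "_ = lie_class G S ?F")
    unfolding eq vir_l_def vir_eq by blast
  have "?E \<in> lie_germ G S ?F \<one>"
    using fun_cong[OF cls, of "\<one>"] lie_germ_refl[OF S one_closed, of ?E]
    by (simp add: lie_class_def)
  then obtain V Q where V: "openin (gtop G) V" "\<one> \<in> V" and Q: "Q \<in> SD G S V"
    and td: "res G S V (?E - ?F) = total_deriv G S V Q"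
    unfolding lie_germ_def by blast
  have "topspace (stop S) \<noteq> {}" "taus S \<noteq> {}"
    using S unfolding is_worldsheet_def by blast+
  then obtain z0 \<tau> where z0: "z0 \<in> topspace (stop S)" and \<tau>: "\<tau> \<in> taus S" by blast
  then obtain W where W: "z0 \<in> W" "is_chart (stop S) (W, sig S)"
    using S unfolding is_worldsheet_def by blast
  define s0 where "s0 = sig S z0"
  let ?ci = "chart_inv (W, sig S)"
  have s0: "s0 \<in> sig S ` W" using W(1) by (simp add: s0_def)
  obtain c N where c: "c \<in> atlas G" "\<one> \<in> fst c" and agree:
    "\<And>w. \<exists>\<delta>>0. \<forall>lo hi a p p'. s0 - \<delta> < lo \<longrightarrow> lo < hi \<longrightarrow> hi < s0 + \<delta> \<longrightarrow>
       [:- lo, 1:] ^ Suc N dvd p - p' \<longrightarrow> [:- hi, 1:] ^ Suc N dvd p - p' \<longrightarrow>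
       (\<exists>s\<in>{lo<..<hi}. s \<in> sig S ` W \<and>
          (\<exists>V' \<subseteq> fst c. openin (gtop G) V' \<and> snd c \<one> + (s - s0) *\<^sub>R w \<in> snd c ` V') \<and>
          (\<forall>r\<in>{p, p'}. (?ci s, \<tau>, test_section c \<one> s0 w a r) \<in> jets G S V) \<and>
          total_deriv G S V Q (?ci s, \<tau>, test_section c \<one> s0 w a p) =
          total_deriv G S V Q (?ci s, \<tau>, test_section c \<one> s0 w a p'))"
    using total_deriv_agree_between[OF Q V(2) W(2) s0 \<tau>] by metis
  define I where "I = (\<lambda>y a. inverse_metric G g y (coordinate_differential c a y)
    (coordinate_differential c a y))"
  have key: "\<exists>s. \<bar>s - s0\<bar> < \<epsilon> \<and> (\<exists>t. t \<noteq> 0 \<and>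
      (1 / (4 * \<kappa>) - h (s + \<tau>) / k) * (A * t)\<^sup>2 * I (chart_inv c (snd c \<one> + (s - s0) *\<^sub>R w)) a +
        (1 / 2 - h (s + \<tau>)) * (A * t * (w \<bullet> a)) =
      (1 / (4 * \<kappa>) - h (s + \<tau>) / k) * (B * t)\<^sup>2 * I (chart_inv c (snd c \<one> + (s - s0) *\<^sub>R w)) a +
        (1 / 2 - h (s + \<tau>)) * (B * t * (w \<bullet> a)))"
    if "\<epsilon> > 0" for \<epsilon> A B w a
  proof -
    obtain \<delta> where \<delta>: "\<delta> > 0" and agree': "\<forall>lo hi a p p'. s0 - \<delta> < lo \<longrightarrow> lo < hi \<longrightarrow> hi < s0 + \<delta> \<longrightarrow>
       [:- lo, 1:] ^ Suc N dvd p - p' \<longrightarrow> [:- hi, 1:] ^ Suc N dvd p - p' \<longrightarrow>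
       (\<exists>s\<in>{lo<..<hi}. s \<in> sig S ` W \<and>
          (\<exists>V' \<subseteq> fst c. openin (gtop G) V' \<and> snd c \<one> + (s - s0) *\<^sub>R w \<in> snd c ` V') \<and>
          (\<forall>r\<in>{p, p'}. (?ci s, \<tau>, test_section c \<one> s0 w a r) \<in> jets G S V) \<and>
          total_deriv G S V Q (?ci s, \<tau>, test_section c \<one> s0 w a p) =
          total_deriv G S V Q (?ci s, \<tau>, test_section c \<one> s0 w a p'))"
      using agree[of w] by blast
    define m where "m = min \<epsilon> \<delta> / 2"
    have m: "m > 0" "m < \<epsilon>" "m < \<delta>" using \<delta> \<open>\<epsilon> > 0\<close> by (auto simp: m_def min_def)
    \<comment> \<open>The momentum vanishes to order \<open>N + 1\<close> at the ends of the interval, whatever its scaling factor.\<close>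
    obtain p :: "real poly" where p: "[:- (s0 - m), 1:] ^ Suc N dvd p" "[:- (s0 + m), 1:] ^ Suc N dvd p"
      "\<And>s. s \<in> {s0 - m<..<s0 + m} \<Longrightarrow> poly p s \<noteq> 0"
      using ex_poly_vanishing_at_endpoints[of "s0 - m" "Suc N" "s0 + m"] by metis
    have "[:- t, 1:] ^ Suc N dvd smult A p - smult B p" if "[:- t, 1:] ^ Suc N dvd p" for t
      using that by (intro dvd_diff dvd_smult)
    note dvd = this[OF p(1)] this[OF p(2)]
    have lim: "s0 - \<delta> < s0 - m" "s0 - m < s0 + m" "s0 + m < s0 + \<delta>" using m by auto
    obtain s V' where s: "s \<in> {s0 - m<..<s0 + m}" "s \<in> sig S ` W"
      and V': "openin (gtop G) V'" "V' \<subseteq> fst c" "snd c \<one> + (s - s0) *\<^sub>R w \<in> snd c ` V'"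
      and jets: "\<And>r. r \<in> {smult A p, smult B p} \<Longrightarrow> (?ci s, \<tau>, test_section c \<one> s0 w a r) \<in> jets G S V"
      and td_eq: "total_deriv G S V Q (?ci s, \<tau>, test_section c \<one> s0 w a (smult A p)) =
          total_deriv G S V Q (?ci s, \<tau>, test_section c \<one> s0 w a (smult B p))"
      using agree'[rule_format, OF lim dvd, of a] by blast
    have sig: "sig S (?ci s) = s" using s(2) by (auto simp: f_inv_into_f)
    have "V \<subseteq> carrier G" using openin_subset[OF V(1)] topspace_eq by simp
    then have sub: "jets G S V \<subseteq> jets G S (carrier G)" by (auto simp: jets_def)
    define y where "y = chart_inv c (snd c \<one> + (s - s0) *\<^sub>R w)"
    have val: "total_deriv G S V Q (?ci s, \<tau>, test_section c \<one> s0 w a (smult r p)) =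
        (1 / (4 * \<kappa>) - h (s + \<tau>) / k) * (r * poly p s)\<^sup>2 * I y a +
        (1 / 2 - h (s + \<tau>)) * (r * poly p s * (w \<bullet> a)) +
        (\<kappa> - h (s + \<tau>) * k) / 4 * metric G g y (coord_vec G c y w) (coord_vec G c y w)"
      if "r \<in> {A, B}" for r
    proof -
      let ?u = "test_section c \<one> s0 w a (smult r p)"
      have j: "(?ci s, \<tau>, ?u) \<in> jets G S V" using that jets by auto
      then have "total_deriv G S V Q (?ci s, \<tau>, ?u) =
          ?E (?ci s, \<tau>, ?u) - h (s + \<tau>) * ?L (?ci s, \<tau>, ?u)"
        using sig unfolding td[symmetric] by (simp add: res_def)
      then show ?thesis
        using defect_at_test_section[OF k \<kappa> c(1) V' sig subsetD[OF sub j]]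
        by (simp add: I_def y_def)
    qed
    have "\<bar>s - s0\<bar> < \<epsilon>" "poly p s \<noteq> 0" using s(1) m p(3) by auto
    then show ?thesis
      using td_eq val[of A] val[of B] unfolding y_def
      by (intro exI[of _ s] conjI exI[of _ "poly p s"]) simp_all
  qed
  have cont: "isCont (\<lambda>s. h (s + \<tau>)) s0"
  proof -
    have "isCont h (s0 + \<tau>)"
      using smooth_on_imp_continuous_on[OF h] by (simp add: continuous_on_eq_continuous_at)
    then show ?thesis by (rule isCont_o2[where f = "\<lambda>s. s + \<tau>", rotated]) simp
  qed
  have "h (s0 + \<tau>) = 1 / 2"
  proof (rule ex_close_imp_eq[OF cont])
    fix \<epsilon> :: real assume "\<epsilon> > 0"
    \<comment> \<open>Opposite momenta on a moving curve: only the terms linear in the momentum differ.\<close>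
    obtain b :: 'e where b: "b \<in> Basis" using nonempty_Basis by blast
    then show "\<exists>t. \<bar>t - s0\<bar> < \<epsilon> \<and> h (t + \<tau>) = 1 / 2"
      using key[OF \<open>\<epsilon> > 0\<close>, of 1 b b "-1"] by auto
  qed
  moreover have "h (s0 + \<tau>) = k / (4 * \<kappa>)"
  proof (rule ex_close_imp_eq[OF cont])
    fix \<epsilon> :: real assume "\<epsilon> > 0"
    \<comment> \<open>A nonzero and a zero momentum on a constant curve: the term linear in the momentum vanishes.\<close>
    obtain a where a: "I \<one> a \<noteq> 0"
      using ex_coordinate_differential_nonnull[OF c] unfolding I_def by metis
    have "chart_inv c (snd c \<one>) = \<one>" using c by (simp add: chart_left)
    then obtain s t where s: "\<bar>s - s0\<bar> < \<epsilon>" "t \<noteq> 0"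
      "(1 / (4 * \<kappa>) - h (s + \<tau>) / k) * t\<^sup>2 * I \<one> a = 0"
      using key[OF \<open>\<epsilon> > 0\<close>, of 1 0 a 0] by auto
    then have "h (s + \<tau>) / k = 1 / (4 * \<kappa>)" using a by simp
    then have "h (s + \<tau>) = k / (4 * \<kappa>)" using k by (simp add: field_simps)
    with s(1) show "\<exists>t. \<bar>t - s0\<bar> < \<epsilon> \<and> h (t + \<tau>) = k / (4 * \<kappa>)" by blast
  qed
  ultimately have "1 / 2 = k / (4 * \<kappa>)" by simp
  then show ?thesis using \<kappa> by (simp add: field_simps)
qed

theorem vir_eq_iff_level:
  assumes S: "is_worldsheet S" and k: "k \<noteq> 0" and \<kappa>: "\<kappa> \<noteq> 0"
  shows "vir_plus G S g \<kappa> = vir_l G S g k d e e' \<and> vir_minus G S g \<kappa> = vir_r G S g k d e e'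
    \<longleftrightarrow> \<kappa> = k / 2"
proof
  assume level: "\<kappa> = k / 2"
  show "vir_plus G S g \<kappa> = vir_l G S g k d e e' \<and> vir_minus G S g \<kappa> = vir_r G S g k d e e'"
    unfolding level vir_plus_def vir_minus_def vir_l_def vir_r_def energy_eq_half_sugawara[OF k]
    by (simp add: vir_scale)
qed (use vir_plus_eq_vir_l_imp_level[OF assms] in blast)

end

section \<open>The general linear group with the trace form\<close>

lemma GL_simps [simp]:
  "carrier GL = {A. invertible A}" "A \<otimes>\<^bsub>GL\<^esub> B = A ** B" "\<one>\<^bsub>GL\<^esub> = mat 1"
  "gtop GL = top_of_set {A. invertible A}" "atlas GL = {({A. invertible A}, \<lambda>A. A)}"
  by (simp_all add: GL_def)

lemma open_invertible: "open {A :: real^'n^'n. invertible A}"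
proof -
  have "continuous_on UNIV (det :: real^'n^'n \<Rightarrow> real)"
    unfolding det_def by (intro continuous_intros)
  then have "open {A :: real^'n^'n. det A \<noteq> 0}"
    by (intro open_Collect_neq continuous_on_const) auto
  then show ?thesis by (simp add: invertible_det_nz)
qed

lemma invertible_mat_1: "invertible (mat 1 :: real^'n^'n)"
  by (simp add: invertible_det_nz)

lemma second_countable_euclidean:
  "second_countable (euclidean :: 'a::second_countable_topology topology)"
proof -
  obtain B :: "'a set set" where B: "countable B" "topological_basis B"
    using ex_countable_basis by blast
  have "\<exists>V\<in>B. x \<in> V \<and> V \<subseteq> U" if "open U" "x \<in> U" for U x
    using topological_basisE[OF B(2) that] by metis
  with B show ?thesis
    unfolding second_countable_def using topological_basis_open[OF B(2)]
    by (intro exI[of _ B]) simp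
qed

lemma matrix_mult_add_left: "(A + B) ** C = A ** C + B ** C" for A B :: "real^'n^'m" and C :: "real^'p^'n"
  by (simp add: matrix_matrix_mult_def vec_eq_iff sum.distrib algebra_simps)

lemma bounded_linear_matrix_mult:
  fixes h :: "real^'n^'n"
  shows "bounded_linear (\<lambda>A. h ** A)" "bounded_linear (\<lambda>A. A ** h)"
  by (auto intro!: linear_conv_bounded_linear[THEN iffD1] linearI
      simp: matrix_add_ldistrib matrix_mult_add_left matrix_scalar_ac scalar_matrix_assoc)

lemma smooth_group_GL: "smooth_group (GL :: (real^'n^'n, real^'n^'n) lie_group)"
proof -
  let ?U = "{A :: real^'n^'n. invertible A}"
  have inv: "inv_into ?U (\<lambda>A. A) A = A" if "invertible A" for A
    using inv_into_f_f[of "\<lambda>A. A" ?U A] that by (simp add: inj_on_def)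
  have chart: "is_chart (top_of_set ?U) (?U, \<lambda>A. A)"
    using homeomorphic_map_id[of "top_of_set ?U"] open_invertible
    by (simp add: is_chart_def id_def subtopology_subtopology)
  have smooth_id: "smooth_on ?U (inv_into ?U (\<lambda>A. A))"
    by (rule smooth_on_cong[OF open_invertible
          smooth_on_subset[OF smooth_on_bounded_linear[OF bounded_linear_ident]]])
       (simp_all add: inv)
  have lin: "smooth_map GL L" if L: "bounded_linear L" and "\<And>A. invertible A \<Longrightarrow> invertible (L A)"
    for L :: "real^'n^'n \<Rightarrow> real^'n^'n"
  proof -
    have "continuous_on ?U L" using L by (rule linear_continuous_on)
    moreover have "smooth_on ?U (\<lambda>A. L (inv_into ?U (\<lambda>A. A) A))"
      by (rule smooth_on_linear[OF L open_invertible smooth_id])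
    moreover have "{A. invertible A \<and> invertible (L A)} = ?U" using that(2) by auto
    ultimately show ?thesis
      using that(2) by (auto simp: smooth_map_def continuous_map_in_subtopology o_def)
  qed
  have grp: "group (GL :: (real^'n^'n, real^'n^'n) lie_group)"
  proof (rule groupI)
    fix A assume "A \<in> carrier (GL :: (real^'n^'n, real^'n^'n) lie_group)"
    then obtain B where "A ** B = mat 1" "B ** A = mat 1" by (auto simp: invertible_def)
    then show "\<exists>B\<in>carrier GL. B \<otimes>\<^bsub>GL\<^esub> A = \<one>\<^bsub>GL\<^esub>"
      by (intro bexI[of _ B]) (auto simp: invertible_def)
  qed (simp_all add: invertible_det_nz det_mul matrix_mul_assoc)
  interpret group "GL :: (real^'n^'n, real^'n^'n) lie_group" by (rule grp)
  show ?thesis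
  proof unfold_locales
    show "smooth_manifold (gtop GL) (atlas (GL :: (real^'n^'n, real^'n^'n) lie_group))"
      using chart smooth_id
      by (simp add: smooth_manifold_def o_def Hausdorff_space_subtopology
          second_countable_subtopology second_countable_euclidean)
    show "smooth_map GL (\<lambda>x. h \<otimes>\<^bsub>GL\<^esub> x)" "smooth_map GL (\<lambda>x. x \<otimes>\<^bsub>GL\<^esub> h)"
      if "h \<in> carrier GL" for h :: "real^'n^'n"
      using that by (auto intro!: lin bounded_linear_matrix_mult invertible_mult)
  qed auto
qed

lemma GL_tangent_space:
  fixes A :: "real^'n^'n"
  assumes "invertible A"
  shows "tangent_space GL A = range (coord_vec GL ({A. invertible A}, \<lambda>A. A) A)"
  using assms
    smooth_group.tangent_space_eq_range[OF smooth_group_GL, of "({A. invertible A}, \<lambda>A. A)" A]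
  by simp

text \<open>In the tautological chart a tangent vector is a matrix, and a linear function is its own
  derivative. Applied to the matrix entries, this recovers the matrix from the tangent vector.\<close>

lemma GL_coord_vec_linear:
  fixes A :: "real^'n^'n"
  assumes L: "bounded_linear L" and A: "invertible A"
  shows "coord_vec GL ({A. invertible A}, \<lambda>A. A) A a L = L a"
proof -
  let ?U = "{A :: real^'n^'n. invertible A}"
  have inv: "inv_into ?U (\<lambda>A. A) B = B" if "B \<in> ?U" for B
    using inv_into_f_f[of "\<lambda>A. A" ?U B] that by (simp add: inj_on_def)
  have "smooth_on ?U (L \<circ> inv_into ?U (\<lambda>A. A))"
    by (rule smooth_on_cong[OF open_invertible smooth_on_subset[OF smooth_on_bounded_linear[OF L]]])
       (simp_all add: inv)
  then have "smooth_near GL A L"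
    using A unfolding smooth_near_def by (intro exI[of _ ?U]) auto
  moreover have "(L \<circ> inv_into ?U (\<lambda>A. A) has_derivative L) (at A)"
    by (rule has_derivative_transform_within_open[OF bounded_linear_imp_has_derivative[OF L]
          open_invertible])
       (use A in \<open>simp_all add: inv\<close>)
  then have "frechet_derivative (L \<circ> inv_into ?U (\<lambda>A. A)) (at A) = L"
    by (metis frechet_derivative_at)
  ultimately show ?thesis by (simp add: coord_vec_def)
qed

lemma bounded_linear_entry: "bounded_linear (\<lambda>A :: real^'n^'n. A $ i $ j)"
  by (intro bounded_linear_compose[OF bounded_linear_vec_nth] bounded_linear_vec_nth)

lemma gl_matrix_coord_vec:
  "gl_matrix (coord_vec GL ({A. invertible A}, \<lambda>A. A) (mat 1) a) = a" for a :: "real^'n^'n"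
  by (simp add: gl_matrix_def vec_eq_iff GL_coord_vec_linear[OF bounded_linear_entry invertible_mat_1])

lemma lie_algebra_GL_cases:
  assumes "y \<in> lie_algebra (GL :: (real^'n^'n, real^'n^'n) lie_group)"
  obtains a where "y = coord_vec GL ({A. invertible A}, \<lambda>A. A) (mat 1) a" "gl_matrix y = a"
  using assms GL_tangent_space[of "mat 1"] gl_matrix_coord_vec
  by (auto simp: lie_algebra_def invertible_det_nz)

lemma gl_matrix_adjoint:
  fixes h :: "real^'n^'n"
  assumes y: "y \<in> lie_algebra GL"
  shows "gl_matrix (adjoint GL h y) = h ** gl_matrix y ** (inv\<^bsub>GL\<^esub> h)"
proof -
  obtain a where a: "y = coord_vec GL ({A. invertible A}, \<lambda>A. A) (mat 1) a" "gl_matrix y = a"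
    using lie_algebra_GL_cases[OF y] .
  have "y (\<lambda>w. (h ** w ** (inv\<^bsub>GL\<^esub> h)) $ i $ j) = (h ** a ** (inv\<^bsub>GL\<^esub> h)) $ i $ j" for i j
    unfolding a(1)
    by (intro GL_coord_vec_linear bounded_linear_compose[OF bounded_linear_entry]
        bounded_linear_compose[OF bounded_linear_matrix_mult(2)] bounded_linear_matrix_mult)
       (simp add: invertible_det_nz)
  then show ?thesis
    unfolding gl_matrix_def[of "adjoint GL h y"] a(2)
    by (simp add: vec_eq_iff adjoint_def push_def o_def)
qed

lemma trace_conjugate:
  fixes h h' :: "real^'n^'n"
  assumes "h' ** h = mat 1"
  shows "trace ((h ** A ** h') ** (h ** B ** h')) = trace (A ** B)"
proof -
  have "(h ** A ** h') ** (h ** B ** h') = h ** (A ** (h' ** h) ** B) ** h'"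
    by (simp add: matrix_mul_assoc)
  also have "trace \<dots> = trace (h' ** h ** (A ** B))"
    by (subst trace_mul_sym) (simp add: assms matrix_mul_assoc)
  finally show ?thesis by (simp add: assms)
qed

text \<open>The trace form is nondegenerate because a matrix paired with its transpose gives its Euclidean
  square length.\<close>

lemma trace_mult_transpose: "trace (A ** transpose A) = A \<bullet> A" for A :: "real^'n^'n"
  by (simp add: trace_def matrix_matrix_mult_def transpose_def inner_vec_def)

lemma invariant_form_trace_form:
  "invariant_form (GL :: (real^'n^'n, real^'n^'n) lie_group) trace_form"
proof -
  interpret smooth_group "GL :: (real^'n^'n, real^'n^'n) lie_group" by (rule smooth_group_GL)
  let ?c = "({A :: real^'n^'n. invertible A}, \<lambda>A. A)"
  have one: "invertible (mat 1 :: real^'n^'n)" by (simp add: invertible_det_nz)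
  have add: "gl_matrix (v + w) = gl_matrix v + gl_matrix w"
    and scale: "gl_matrix (r *\<^sub>R v) = r *\<^sub>R gl_matrix v" for r and v w :: "(real^'n^'n) tvec"
    by (simp_all add: gl_matrix_def vec_eq_iff scaleR_fun_def)
  have tr: "trace (r *\<^sub>R A) = r * trace A" for r and A :: "real^'n^'n"
    by (simp add: trace_def sum_distrib_left)
  have nondeg: "y = 0" if y: "y \<in> lie_algebra GL"
    and zero: "\<And>z. z \<in> lie_algebra GL \<Longrightarrow> trace_form y z = 0" for y :: "(real^'n^'n) tvec"
  proof -
    obtain a where a: "y = coord_vec GL ?c (mat 1) a" "gl_matrix y = a"
      using lie_algebra_GL_cases[OF y] .
    have "coord_vec GL ?c (mat 1) (transpose a) \<in> lie_algebra GL"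
      by (simp add: lie_algebra_def GL_tangent_space[OF one])
    from zero[OF this] have "a = 0"
      by (simp add: trace_form_def a(2) gl_matrix_coord_vec trace_mult_transpose)
    then show ?thesis using coord_vec_scale[of ?c "mat 1" 0 0] one by (simp add: a(1))
  qed
  have adj: "trace_form (adjoint GL h x) (adjoint GL h y) = trace_form x y"
    if "h \<in> carrier GL" "x \<in> lie_algebra GL" "y \<in> lie_algebra GL"
    for h :: "real^'n^'n" and x y
    using that l_inv[of h] by (simp add: trace_form_def gl_matrix_adjoint trace_conjugate)
  show ?thesis
    unfolding invariant_form_def
  proof (intro conjI ballI allI impI)
    fix x y z :: "(real^'n^'n) tvec" and r :: real
    show "trace_form (x + y) z = trace_form x z + trace_form y z"
      by (simp add: trace_form_def add matrix_mult_add_left trace_add)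
    show "trace_form (r *\<^sub>R x) y = r * trace_form x y"
      by (simp add: trace_form_def scale scalar_matrix_assoc[symmetric] tr)
    show "trace_form x y = trace_form y x"
      unfolding trace_form_def by (rule trace_mul_sym)
  next
    fix y :: "(real^'n^'n) tvec"
    assume "y \<in> lie_algebra GL" "\<forall>z\<in>lie_algebra GL. trace_form y z = 0"
    then show "y = 0" by (intro nondeg) auto
  qed (rule adj)
qed

section \<open>Equality of the Virasoro subspaces\<close>

theorem lemma2p9p2p1:
  fixes S :: "'s worldsheet" and k \<kappa> :: real
    and G :: "('g, 'e::euclidean_space) lie_group" and g :: "'g tvec \<Rightarrow> 'g tvec \<Rightarrow> real"
    and d :: nat and e e' :: "nat \<Rightarrow> 'g tvec"
    and m :: nat and b b' :: "nat \<Rightarrow> (real^'n^'n) tvec"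
  assumes "is_worldsheet S" and "k \<noteq> 0" and "\<kappa> \<noteq> 0"
  shows "(compact_simple G \<and> invariant_form G g \<and> dual_bases G g d e e' \<longrightarrow>
            (vir_plus G S g \<kappa> = vir_l G S g k d e e' \<and> vir_minus G S g \<kappa> = vir_r G S g k d e e'
             \<longleftrightarrow> \<kappa> = k / 2))
       \<and> (dual_bases GL trace_form m b b' \<longrightarrow>
            (vir_plus GL S trace_form \<kappa> = vir_l GL S trace_form k m b b' \<and>
             vir_minus GL S trace_form \<kappa> = vir_r GL S trace_form k m b b'
             \<longleftrightarrow> \<kappa> = k / 2))"
proof (intro conjI impI)
  assume "compact_simple G \<and> invariant_form G g \<and> dual_bases G g d e e'"
  then interpret metric_group G g d e e'
    by (intro metric_group.intro metric_group_axioms.intro lie_group_imp_smooth_group)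
       (simp_all add: compact_simple_def)
  show "vir_plus G S g \<kappa> = vir_l G S g k d e e' \<and> vir_minus G S g \<kappa> = vir_r G S g k d e e'
      \<longleftrightarrow> \<kappa> = k / 2"
    by (rule vir_eq_iff_level[OF assms])
next
  assume "dual_bases GL trace_form m b b'"
  then interpret metric_group GL trace_form m b b'
    by (intro metric_group.intro metric_group_axioms.intro smooth_group_GL invariant_form_trace_form)
  show "vir_plus GL S trace_form \<kappa> = vir_l GL S trace_form k m b b' \<and>
      vir_minus GL S trace_form \<kappa> = vir_r GL S trace_form k m b b' \<longleftrightarrow> \<kappa> = k / 2"
    by (rule vir_eq_iff_level[OF assms])
qed

end
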